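(* Let $A$ be any operator algebra. (1) $A_H = \overline{\mathrm{Span}}(\mathfrak{r}_A)$, and $\mathfrak{r}_A = \mathfrak{r}_{A_H} \subset A_H$. (2) $A$ has a contractive approximate identity if and only if $A = \overline{\mathrm{Span}}(\mathfrak{r}_A)$.
   Context: An operator algebra is a norm closed algebra $A$ of operators on a Hilbert space $H$, not assumed to have an identity. The unitization $A^1$ equals $A$ if $A$ has an identity of norm $1$, and otherwise is $A + \mathbb{C} I_H$ (by a theorem of Meyer it does not depend on the completely isometric representation); $1$ is the identity of $A^1$. $\mathfrak{F}_A = \{ x \in A : \Vert 1 - x \Vert_{A^1} \leq 1 \}$, and $\mathfrak{r}_A = \{ a \in A : a + a^* \geq 0 \}$, where positivity is in $B(H)$ and does not depend on the (completely isometric) representation. $A_H$ denotes the norm closure of the linear span of all products $x a y$ with $x, y \in \mathfrak{F}_A$ and $a \in A$; it is a closed subalgebra of $A$. $\overline{\mathrm{Span}}$ denotes the norm closed linear span. A contractive approximate identity is a net $(e_t)$ in the closed unit ball of $A$ with $e_t x \to x$ and $x e_t \to x$ in norm for all $x \in A$. *)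

theory Defs
  imports "HOL-Analysis.Analysis"
begin

section \<open>Complex normed spaces and Hilbert spaces\<close>

class complex_normed_vector = real_normed_vector +
  fixes scaleC :: "complex \<Rightarrow> 'a \<Rightarrow> 'a"  (infixr \<open>*\<^sub>C\<close> 75)
  assumes scaleC_add_right: "c *\<^sub>C (x + y) = c *\<^sub>C x + c *\<^sub>C y"
    and scaleC_add_left: "(c + d) *\<^sub>C x = c *\<^sub>C x + d *\<^sub>C x"
    and scaleC_scaleC: "c *\<^sub>C d *\<^sub>C x = (c * d) *\<^sub>C x"
    and scaleC_of_real: "complex_of_real r *\<^sub>C x = r *\<^sub>R x"
    and norm_scaleC: "norm (c *\<^sub>C x) = cmod c * norm x"

lemma scaleC_one: "1 *\<^sub>C x = (x :: 'a :: complex_normed_vector)"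
  using scaleC_of_real[of 1 x] by simp

global_interpretation complex_vector:
  vector_space "scaleC :: complex \<Rightarrow> 'a \<Rightarrow> 'a :: complex_normed_vector"
  by unfold_locales
    (simp_all add: scaleC_add_right scaleC_add_left scaleC_scaleC scaleC_one)

class complex_hilbert_space = complex_normed_vector + complete_space +
  fixes cinner :: "'a \<Rightarrow> 'a \<Rightarrow> complex"
  assumes cinner_add_left: "cinner (x + y) z = cinner x z + cinner y z"
    and cinner_scaleC_left: "cinner (c *\<^sub>C x) y = c * cinner x y"
    and cinner_commute: "cinner y x = cnj (cinner x y)"
    and cinner_self: "cinner x x = complex_of_real ((norm x)\<^sup>2)"


section \<open>Bounded operators\<close>

text \<open>
  The library type of bounded linear functions consists of the real-linear ones, with the
  operator norm. \<open>B(H)\<close> is the set of those that are complex-linear.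
\<close>

lemma bounded_linear_scaleC:
  "bounded_linear (\<lambda>x. c *\<^sub>C x :: 'a :: complex_normed_vector)"
proof (rule bounded_linear_intro[where K = "cmod c"])
  fix r :: real and x :: 'a
  show "c *\<^sub>C r *\<^sub>R x = r *\<^sub>R c *\<^sub>C x"
    by (simp add: scaleC_scaleC mult.commute flip: scaleC_of_real)
qed (simp_all add: scaleC_add_right norm_scaleC mult.commute)

instantiation blinfun :: (real_normed_vector, complex_normed_vector) complex_normed_vector
begin

lift_definition scaleC_blinfun :: "complex \<Rightarrow> 'a \<Rightarrow>\<^sub>L 'b \<Rightarrow> 'a \<Rightarrow>\<^sub>L 'b" is "\<lambda>c T x. c *\<^sub>C T x"
  by (rule bounded_linear_compose[OF bounded_linear_scaleC])

instance
proof
  have le: "norm (c *\<^sub>C T) \<le> cmod c * norm T" for c and T :: "'a \<Rightarrow>\<^sub>L 'b"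
  proof (rule norm_blinfun_bound)
    fix x
    show "norm (blinfun_apply (c *\<^sub>C T) x) \<le> cmod c * norm T * norm x"
      using mult_left_mono[OF norm_blinfun[of T x], of "cmod c"]
      by (simp add: scaleC_blinfun.rep_eq norm_scaleC mult.assoc)
  qed simp
  fix c d :: complex and r :: real and S T :: "'a \<Rightarrow>\<^sub>L 'b"
  show "c *\<^sub>C (S + T) = c *\<^sub>C S + c *\<^sub>C T"
    by transfer (simp add: scaleC_add_right)
  show "(c + d) *\<^sub>C T = c *\<^sub>C T + d *\<^sub>C T"
    by transfer (simp add: scaleC_add_left)
  show scale: "c *\<^sub>C d *\<^sub>C T = (c * d) *\<^sub>C T" for c d
    by transfer (simp add: scaleC_scaleC)
  show "complex_of_real r *\<^sub>C T = r *\<^sub>R T" for r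
    by transfer (simp add: scaleC_of_real)
  show "norm (c *\<^sub>C T) = cmod c * norm T"
  proof (cases "c = 0")
    case False
    have one: "1 *\<^sub>C T = T"
      by transfer (simp add: scaleC_one)
    have "norm T = norm (inverse c *\<^sub>C c *\<^sub>C T)"
      using False by (simp add: scale one)
    also have "\<dots> \<le> cmod (inverse c) * norm (c *\<^sub>C T)"
      by (rule le)
    finally have "cmod c * norm T \<le> norm (c *\<^sub>C T)"
      using False by (simp add: norm_divide field_simps)
    then show ?thesis
      using le[of c T] by simp
  qed (use le[of 0 T] in simp)
qed

end

definition bounded_ops :: "('h :: complex_hilbert_space \<Rightarrow>\<^sub>L 'h) set" where
  "bounded_ops = {T. \<forall>c x. blinfun_apply T (c *\<^sub>C x) = c *\<^sub>C T x}"

text \<open>Existence and uniqueness on \<open>B(H)\<close> are the Riesz representation theorem.\<close>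

definition adj :: "('h :: complex_hilbert_space \<Rightarrow>\<^sub>L 'h) \<Rightarrow> 'h \<Rightarrow>\<^sub>L 'h" where
  "adj T = (THE S. \<forall>x y. cinner (T x) y = cinner x (blinfun_apply S y))"

definition positive_op :: "('h :: complex_hilbert_space \<Rightarrow>\<^sub>L 'h) \<Rightarrow> bool" where
  "positive_op T \<longleftrightarrow> T \<in> bounded_ops \<and> (\<forall>x. cinner (T x) x \<in> \<real>\<^sub>\<ge>\<^sub>0)"


section \<open>Operator algebras\<close>

definition operator_algebra :: "('h :: complex_hilbert_space \<Rightarrow>\<^sub>L 'h) set \<Rightarrow> bool" where
  "operator_algebra A \<longleftrightarrow>
     A \<subseteq> bounded_ops \<and> complex_vector.subspace A \<and>
     (\<forall>S\<in>A. \<forall>T\<in>A. S o\<^sub>L T \<in> A) \<and> closed A"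

definition is_identity ::
    "('h :: complex_hilbert_space \<Rightarrow>\<^sub>L 'h) set \<Rightarrow> ('h \<Rightarrow>\<^sub>L 'h) \<Rightarrow> bool" where
  "is_identity A e \<longleftrightarrow> e \<in> A \<and> (\<forall>a\<in>A. e o\<^sub>L a = a \<and> a o\<^sub>L e = a)"

definition unitization ::
    "('h :: complex_hilbert_space \<Rightarrow>\<^sub>L 'h) set \<Rightarrow> ('h \<Rightarrow>\<^sub>L 'h) set" where
  "unitization A =
     (if \<exists>e. is_identity A e \<and> norm e = 1 then A
      else {a + c *\<^sub>C id_blinfun | a c. a \<in> A})"

text \<open>This need not be the identity operator of \<open>H\<close>: \<open>A\<close> may act degenerately.\<close>

definition unit_of :: "('h :: complex_hilbert_space \<Rightarrow>\<^sub>L 'h) set \<Rightarrow> 'h \<Rightarrow>\<^sub>L 'h" where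
  "unit_of A = (THE e. is_identity (unitization A) e)"

definition frak_F ::
    "('h :: complex_hilbert_space \<Rightarrow>\<^sub>L 'h) set \<Rightarrow> ('h \<Rightarrow>\<^sub>L 'h) set" where
  "frak_F A = {x \<in> A. norm (unit_of A - x) \<le> 1}"

definition frak_r ::
    "('h :: complex_hilbert_space \<Rightarrow>\<^sub>L 'h) set \<Rightarrow> ('h \<Rightarrow>\<^sub>L 'h) set" where
  "frak_r A = {a \<in> A. positive_op (a + adj a)}"

definition closed_span :: "'a :: complex_normed_vector set \<Rightarrow> 'a set" where
  "closed_span S = closure (complex_vector.span S)"

definition sub_H ::
    "('h :: complex_hilbert_space \<Rightarrow>\<^sub>L 'h) set \<Rightarrow> ('h \<Rightarrow>\<^sub>L 'h) set" where
  "sub_H A = closed_span {x o\<^sub>L a o\<^sub>L y | x a y. x \<in> frak_F A \<and> a \<in> A \<and> y \<in> frak_F A}"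


section \<open>Contractive approximate identities\<close>

definition directed :: "'i set \<Rightarrow> ('i \<Rightarrow> 'i \<Rightarrow> bool) \<Rightarrow> bool" where
  "directed I le \<longleftrightarrow>
     I \<noteq> {} \<and> reflp_on I le \<and> transp_on I le \<and>
     (\<forall>s\<in>I. \<forall>t\<in>I. \<exists>u\<in>I. le s u \<and> le t u)"

definition net_tendsto ::
    "'i set \<Rightarrow> ('i \<Rightarrow> 'i \<Rightarrow> bool) \<Rightarrow> ('i \<Rightarrow> 'a :: real_normed_vector) \<Rightarrow> 'a \<Rightarrow> bool" where
  "net_tendsto I le f l \<longleftrightarrow>
     (\<forall>\<epsilon>>0. \<exists>s\<in>I. \<forall>t\<in>I. le s t \<longrightarrow> norm (f t - l) < \<epsilon>)"

definition is_cai ::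
    "('h :: complex_hilbert_space \<Rightarrow>\<^sub>L 'h) set \<Rightarrow> 'i set \<Rightarrow> ('i \<Rightarrow> 'i \<Rightarrow> bool) \<Rightarrow>
     ('i \<Rightarrow> 'h \<Rightarrow>\<^sub>L 'h) \<Rightarrow> bool" where
  "is_cai A I le e \<longleftrightarrow>
     directed I le \<and> (\<forall>t\<in>I. e t \<in> A \<and> norm (e t) \<le> 1) \<and>
     (\<forall>x\<in>A. net_tendsto I le (\<lambda>t. e t o\<^sub>L x) x \<and> net_tendsto I le (\<lambda>t. x o\<^sub>L e t) x)"

text \<open>
  One cannot quantify existentially over the type of the index set, so a type is fixed. The
  lemma \<open>has_caiI\<close> below shows that this is no restriction: a contractive approximate identity
  over a directed set of any type can be reindexed by pairs of a value and a tail of the net.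
\<close>

definition has_cai :: "('h :: complex_hilbert_space \<Rightarrow>\<^sub>L 'h) set \<Rightarrow> bool" where
  "has_cai A \<longleftrightarrow>
     (\<exists>(I :: (('h \<Rightarrow>\<^sub>L 'h) \<times> ('h \<Rightarrow>\<^sub>L 'h) set) set) le e. is_cai A I le e)"

lemma has_caiI:
  fixes I :: "'i set"
  assumes "is_cai A I le e"
  shows "has_cai A"
proof -
  define tail where "tail s = e ` {t \<in> I. le s t}" for s
  define J where "J = {(T, S). \<exists>s\<in>I. S = tail s \<and> T \<in> S}"
  define leJ :: "('a \<Rightarrow>\<^sub>L 'a) \<times> ('a \<Rightarrow>\<^sub>L 'a) set \<Rightarrow> ('a \<Rightarrow>\<^sub>L 'a) \<times> ('a \<Rightarrow>\<^sub>L 'a) set \<Rightarrow> bool"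
    where "leJ p q \<longleftrightarrow> snd q \<subseteq> snd p" for p q
  have dir: "directed I le"
    using assms by (simp add: is_cai_def)
  have self: "(e s, tail s) \<in> J" if "s \<in> I" for s
    using that dir unfolding J_def tail_def directed_def by (auto dest: reflp_onD)
  have mono: "tail t \<subseteq> tail s" if "s \<in> I" "t \<in> I" "le s t" for s t
    using that dir unfolding tail_def directed_def by (auto dest: transp_onD)
  have "directed J leJ"
    unfolding directed_def
  proof (intro conjI ballI)
    show "J \<noteq> {}"
      using self dir by (auto simp: directed_def)
    show "reflp_on J leJ" "transp_on J leJ"
      by (auto simp: leJ_def reflp_on_def transp_on_def)
    fix p q
    assume "p \<in> J" "q \<in> J"
    then obtain s t where st: "s \<in> I" "t \<in> I" "snd p = tail s" "snd q = tail t"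
      by (auto simp: J_def)
    then obtain u where u: "u \<in> I" "le s u" "le t u"
      using dir unfolding directed_def by blast
    show "\<exists>r\<in>J. leJ p r \<and> leJ q r"
      using self[OF u(1)] mono st u by (intro bexI[of _ "(e u, tail u)"]) (auto simp: leJ_def)
  qed
  moreover have "fst p \<in> A \<and> norm (fst p) \<le> 1" if "p \<in> J" for p
    using that assms by (auto simp: J_def tail_def is_cai_def)
  moreover have tendsto: "net_tendsto J leJ (\<lambda>p. f (fst p)) l"
    if f: "net_tendsto I le (\<lambda>t. f (e t)) l" for f :: "_ \<Rightarrow> 'a \<Rightarrow>\<^sub>L 'a" and l
    unfolding net_tendsto_def
  proof (intro allI impI)
    fix \<epsilon> :: real
    assume "\<epsilon> > 0"
    then obtain s where s: "s \<in> I" "\<forall>t\<in>I. le s t \<longrightarrow> norm (f (e t) - l) < \<epsilon>"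
      using f by (auto simp: net_tendsto_def)
    have "norm (f (fst p) - l) < \<epsilon>" if "p \<in> J" "leJ (e s, tail s) p" for p
    proof -
      have "fst p \<in> tail s"
        using that by (auto simp: J_def leJ_def)
      then show ?thesis
        using s(2) by (auto simp: tail_def)
    qed
    then show "\<exists>q\<in>J. \<forall>p\<in>J. leJ q p \<longrightarrow> norm (f (fst p) - l) < \<epsilon>"
      using self[OF s(1)] by blast
  qed
  ultimately have "is_cai A J leJ fst"
    using assms tendsto[of "\<lambda>T. T o\<^sub>L x" x for x] tendsto[of "\<lambda>T. x o\<^sub>L T" x for x]
    by (simp add: is_cai_def)
  then show ?thesis
    unfolding has_cai_def by blast
qed

end

theory Submission
  imports Defs
begin

text \<open>
  Write \<open>\<rr>\<^sub>A\<close> for the accretive elements of \<open>A\<close> and \<open>\<FF>\<^sub>A\<close> for those with \<open>\<parallel>1 - x\<parallel> \<le> 1\<close>. The latter condition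
  does not depend on the unit (\<open>frak_F_iff\<close>) and gives \<open>x\<^sup>* x \<le> 2 Re x\<close> and \<open>x x\<^sup>* \<le> 2 Re x\<close>.

  For \<open>x, y\<close> in \<open>\<FF>\<^sub>A\<close> and \<open>a\<close> in \<open>A\<close>, these inequalities and Cauchy--Schwarz make
  \<open>\<parallel>a\<parallel> (x + y) \<plusminus> x a y\<close> accretive (\<open>re_ge_0_scaled_sum_plus_sandwich\<close>), so \<open>x a y\<close> lies in the span of
  \<open>\<rr>\<^sub>A\<close>. Conversely, for accretive \<open>a\<close> the elements \<open>x = a (a + \<mu>)\<^bsup>-1\<^esup>\<close> belong to \<open>\<FF>\<^sub>A\<close>, are contractions,
  and satisfy \<open>a - x a = a - a x = \<mu> x\<close> (\<open>accretive_resolvent\<close>), so \<open>a = lim x a x\<close> lies in \<open>A\<^sub>H\<close>. This proves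
  that \<open>A\<^sub>H\<close> is the closed span of \<open>\<rr>\<^sub>A\<close>.

  If \<open>A\<close> is this closed span, the same resolvents, taken for the sum of finitely many elements of
  \<open>\<FF>\<^sub>A\<close>, are contractions that almost fix all of the summands
  (\<open>frak_F_finite_approximate_unit\<close>). They form a net which is an approximate identity on the products
  \<open>x a y\<close>, and these span a dense subspace.

  For the remaining implication, no member of a contractive approximate identity need be close to an
  accretive element. What helps is averaging. Choose \<open>e\<^sub>0, e\<^sub>1, \<dots>\<close> in \<open>A\<close> so that each \<open>e\<^sub>k\<close> almost
  fixes its predecessors and a given \<open>a\<close>. For fixed \<open>h\<close> the parallelogram law bounds the average of
  \<open>Re \<langle>e\<^sub>k h, h\<rangle>\<close> from below by that of \<open>\<parallel>e\<^sub>k h\<parallel>\<^sup>2\<close>, up to a telescoping sum, whereas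
  \<open>Re \<langle>a h, h\<rangle> \<approx> Re \<langle>a e\<^sub>k h, e\<^sub>k h\<rangle> \<ge> - \<parallel>a\<parallel> \<parallel>e\<^sub>k h\<parallel>\<^sup>2\<close>. Hence the average \<open>E\<close> makes \<open>a + \<parallel>a\<parallel> E\<close> almost accretive, and
  \<open>- a + \<parallel>a\<parallel> E\<close> too (\<open>has_cai_almost_accretive\<close>). Repeating the correction with ever smaller
  multiples shows that almost accretive elements are close to accretive ones
  (\<open>has_cai_accretive_nearby\<close>), and half the differences of these approximate \<open>a\<close>.
\<close>

section \<open>Geometry of complex inner products\<close>

instance complex_hilbert_space \<subseteq> banach ..

lemma cinner_add_right: "cinner x (y + z) = cinner x y + cinner x z"
  by (simp add: cinner_add_left cinner_commute[of x])

lemma cinner_scaleC_right: "cinner x (c *\<^sub>C y) = cnj c * cinner x y"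
  by (simp add: cinner_scaleC_left cinner_commute[of x])

lemma cinner_diff_left: "cinner (x - y) z = cinner x z - cinner y z"
  using cinner_add_left[of "x - y" y z] by simp

lemma cinner_diff_right: "cinner x (y - z) = cinner x y - cinner x z"
  using cinner_add_right[of x "y - z" z] by simp

lemma cinner_zero_left [simp]: "cinner 0 x = 0"
  using cinner_diff_left[of 0 0 x] by simp

lemma cinner_zero_right [simp]: "cinner x 0 = 0"
  using cinner_diff_right[of x 0 0] by simp

lemma cinner_scaleR_left: "cinner (r *\<^sub>R x) y = complex_of_real r * cinner x y"
  by (simp add: cinner_scaleC_left flip: scaleC_of_real)

lemma cinner_scaleR_right: "cinner x (r *\<^sub>R y) = complex_of_real r * cinner x y"
  by (simp add: cinner_scaleC_right flip: scaleC_of_real)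

lemma cinner_minus_left: "cinner (- x) y = - cinner x y"
  using cinner_diff_left[of 0 x y] by simp

lemma cinner_sum_left: "cinner (sum f I) x = (\<Sum>i\<in>I. cinner (f i) x)"
  by (induction I rule: infinite_finite_induct) (simp_all add: cinner_add_left)

lemma Re_cinner_commute: "Re (cinner x y) = Re (cinner y x)"
  by (simp add: cinner_commute[of x y])

lemma Re_cinner_self: "Re (cinner x x) = (norm x)\<^sup>2"
  by (simp add: cinner_self)

lemma norm_add_squared: "(norm (x + y))\<^sup>2 = (norm x)\<^sup>2 + 2 * Re (cinner x y) + (norm y)\<^sup>2"
  unfolding Re_cinner_self[symmetric]
  by (simp add: cinner_add_left cinner_add_right Re_cinner_commute[of y x])

lemma norm_diff_squared: "(norm (x - y))\<^sup>2 = (norm x)\<^sup>2 - 2 * Re (cinner x y) + (norm y)\<^sup>2"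
  unfolding Re_cinner_self[symmetric]
  by (simp add: cinner_diff_left cinner_diff_right Re_cinner_commute[of y x])

lemma parallelogram:
  fixes x y :: "'h :: complex_hilbert_space"
  shows "(norm (x - y))\<^sup>2 = 2 * (norm x)\<^sup>2 + 2 * (norm y)\<^sup>2 - (norm (x + y))\<^sup>2"
  by (simp add: norm_add_squared norm_diff_squared)

lemma Re_cinner_le: "Re (cinner x y) \<le> norm x * norm y"
proof -
  have "(norm (x + y))\<^sup>2 \<le> (norm x + norm y)\<^sup>2"
    by (simp add: norm_triangle_ineq power_mono)
  then show ?thesis
    by (simp add: norm_add_squared power2_sum)
qed

lemma abs_Re_cinner_le: "\<bar>Re (cinner x y)\<bar> \<le> norm x * norm y"
  using Re_cinner_le[of x y] Re_cinner_le[of "- x" y] by (simp add: cinner_minus_left)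

lemma norm_cinner_le: "cmod (cinner x y) \<le> norm x * norm y"
proof (cases "cinner x y = 0")
  case False
  define c where "c = cnj (sgn (cinner x y))"
  have "cmod c = 1"
    using False by (simp add: c_def norm_sgn)
  have "cinner (c *\<^sub>C x) y = complex_of_real (cmod (cinner x y))"
    using False complex_norm_square[of "cinner x y"]
    by (simp add: c_def cinner_scaleC_left sgn_eq field_simps power2_eq_square)
  then show ?thesis
    using Re_cinner_le[of "c *\<^sub>C x" y] \<open>cmod c = 1\<close> by (simp add: norm_scaleC)
qed simp

text \<open>
  Otherwise a small step from \<open>r\<close> along \<open>- \<langle>r, k\<rangle> k\<close> would shorten \<open>r\<close>. This yields both the
  Riesz theorem and the selfadjointness of contractive idempotents.
\<close>

lemma orthogonal_if_norm_minimal: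
  assumes "\<And>c. norm r \<le> norm (r + c *\<^sub>C k)"
  shows "cinner r k = 0"
proof -
  define z where "z = cinner r k"
  define t where "t = 1 / ((norm k)\<^sup>2 + 1)"
  have t: "t > 0" "t * (norm k)\<^sup>2 \<le> 1"
    by (auto simp: t_def field_simps add_pos_nonneg intro: add_nonneg_pos)
  define c where "c = complex_of_real (- t) * z"
  have "Re (cnj c * z) = - t * (cmod z)\<^sup>2"
    unfolding c_def cmod_power2 by (simp add: power2_eq_square algebra_simps)
  moreover have "cmod c = t * cmod z"
    using t by (simp add: c_def norm_mult)
  ultimately have "(norm (r + c *\<^sub>C k))\<^sup>2 = (norm r)\<^sup>2 - 2 * t * (cmod z)\<^sup>2 + (t * cmod z * norm k)\<^sup>2"
    by (simp add: norm_add_squared cinner_scaleC_right norm_scaleC flip: z_def)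
  moreover have "(norm r)\<^sup>2 \<le> (norm (r + c *\<^sub>C k))\<^sup>2"
    using assms by (simp add: power_mono)
  ultimately have "t * (2 * (cmod z)\<^sup>2) \<le> t * ((cmod z)\<^sup>2 * (t * (norm k)\<^sup>2))"
    by (simp add: power2_eq_square algebra_simps)
  then have "2 * (cmod z)\<^sup>2 \<le> (cmod z)\<^sup>2 * (t * (norm k)\<^sup>2)"
    using t by simp
  also have "\<dots> \<le> (cmod z)\<^sup>2"
    using mult_left_mono[OF t(2), of "(cmod z)\<^sup>2"] by simp
  finally show ?thesis
    by (simp add: z_def)
qed

text \<open>
  The representing vector is a multiple of the vector \<open>p\<close> of least norm on the hyperplane \<open>f = 1\<close>:
  minimality makes \<open>p\<close> orthogonal to the kernel of \<open>f\<close>.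
\<close>

lemma riesz_representation:
  fixes f :: "'h :: complex_hilbert_space \<Rightarrow> complex"
  assumes add: "\<And>x y. f (x + y) = f x + f y"
    and scale: "\<And>c x. f (c *\<^sub>C x) = c * f x"
    and bound: "\<And>x. cmod (f x) \<le> K * norm x"
  obtains v where "\<And>x. f x = cinner x v"
proof (cases "\<exists>x. f x \<noteq> 0")
  case False
  then show ?thesis
    using that[of 0] by simp
next
  case True
  then obtain x0 where "f x0 \<noteq> 0" by blast
  define D where "D = {norm x | x. f x = 1}"
  have "f (inverse (f x0) *\<^sub>C x0) = 1"
    using \<open>f x0 \<noteq> 0\<close> by (simp add: scale)
  then have D: "D \<noteq> {}" "bdd_below D"
    unfolding D_def by (blast, intro bdd_belowI[of _ 0], auto)
  define d where "d = Inf D"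
  have d_le: "d \<le> norm x" if "f x = 1" for x
    unfolding d_def using D that by (intro cInf_lower) (auto simp: D_def)
  have "d \<ge> 0"
    unfolding d_def using D by (intro cInf_greatest) (auto simp: D_def)
  have "\<exists>x. f x = 1 \<and> norm x < d + 1 / real (Suc n)" for n
    using cInf_lessD[OF D(1), of "d + 1 / real (Suc n)"] by (auto simp: D_def d_def)
  then have "\<exists>x. \<forall>n. f (x n) = 1 \<and> norm (x n) < d + 1 / real (Suc n)"
    by (intro choice allI)
  then obtain x where x: "\<And>n. f (x n) = 1" "\<And>n. norm (x n) < d + 1 / real (Suc n)"
    by blast
  \<comment> \<open>The midpoint of two near-minimisers again lies on the hyperplane, so the parallelogram
    law forces them together.\<close>
  have close: "(norm (x m - x n))\<^sup>2 \<le> (8 * d + 4) / real (Suc N)" if "m \<ge> N" "n \<ge> N" for m n N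
  proof -
    define \<epsilon> where "\<epsilon> = 1 / real (Suc N)"
    have eps: "0 \<le> \<epsilon>" "\<epsilon> \<le> 1"
      by (auto simp: \<epsilon>_def)
    have small: "(norm (x k))\<^sup>2 \<le> (d + \<epsilon>)\<^sup>2" if "k \<ge> N" for k
    proof -
      have "1 / real (Suc k) \<le> \<epsilon>"
        using that by (simp add: \<epsilon>_def frac_le)
      then show ?thesis
        using x(2)[of k] by (intro power_mono) auto
    qed
    have "f ((1 / 2) *\<^sub>C (x m + x n)) = 1"
      using x by (simp add: scale add)
    from d_le[OF this] have "2 * d \<le> norm (x m + x n)"
      by (simp add: norm_scaleC)
    then have "(2 * d)\<^sup>2 \<le> (norm (x m + x n))\<^sup>2"
      using \<open>d \<ge> 0\<close> by (intro power_mono) auto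
    then have "(norm (x m - x n))\<^sup>2 \<le> 4 * (d + \<epsilon>)\<^sup>2 - (2 * d)\<^sup>2"
      using small[OF that(1)] small[OF that(2)] unfolding parallelogram by linarith
    also have "\<dots> = (8 * d + 4 * \<epsilon>) * \<epsilon>"
      by (simp add: power2_eq_square algebra_simps)
    also have "\<dots> \<le> (8 * d + 4) * \<epsilon>"
      using eps by (intro mult_right_mono) auto
    finally show ?thesis
      by (simp add: \<epsilon>_def)
  qed
  have "Cauchy x"
  proof (rule metric_CauchyI)
    fix e :: real
    assume "e > 0"
    obtain N where "real N > (8 * d + 4) / e\<^sup>2"
      using reals_Archimedean2 by blast
    then have "real (Suc N) > (8 * d + 4) / e\<^sup>2"
      by simp
    then have "(8 * d + 4) / real (Suc N) < e\<^sup>2"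
      using \<open>e > 0\<close> by (simp add: field_simps)
    then have "dist (x m) (x n) < e" if "m \<ge> N" "n \<ge> N" for m n
      unfolding dist_norm
      by (rule power2_less_imp_less[OF le_less_trans[OF close[OF that]] less_imp_le[OF \<open>e > 0\<close>]])
    then show "\<exists>N. \<forall>m\<ge>N. \<forall>n\<ge>N. dist (x m) (x n) < e"
      by blast
  qed
  then obtain p where p: "x \<longlonglongrightarrow> p"
    using Cauchy_convergent convergent_def by blast
  have diff: "f (u - w) = f u - f w" for u w
    using add[of "u - w" w] by simp
  have "f p = 1"
  proof -
    have "(\<lambda>n. f (p - x n)) \<longlonglongrightarrow> 0"
    proof (rule Lim_null_comparison)
      show "(\<lambda>n. K * norm (p - x n)) \<longlonglongrightarrow> 0"
        using p by (auto intro!: tendsto_eq_intros)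
    qed (use bound in auto)
    moreover have "f (p - x n) = f p - 1" for n
      by (simp add: diff x)
    ultimately show ?thesis
      by (simp add: LIMSEQ_const_iff)
  qed
  have "norm p \<le> d"
  proof (rule LIMSEQ_le)
    show "(\<lambda>n. norm (x n)) \<longlonglongrightarrow> norm p"
      using p by (rule tendsto_norm)
    show "(\<lambda>n. d + 1 / real (Suc n)) \<longlonglongrightarrow> d"
      using tendsto_add[OF tendsto_const LIMSEQ_inverse_real_of_nat, of d]
      by (simp add: inverse_eq_divide)
  qed (use x(2) less_imp_le in blast)
  have orth: "cinner p k = 0" if "f k = 0" for k
  proof (rule orthogonal_if_norm_minimal)
    fix c
    have "f (p + c *\<^sub>C k) = 1"
      using that \<open>f p = 1\<close> by (simp add: add scale)
    from d_le[OF this] show "norm p \<le> norm (p + c *\<^sub>C k)"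
      using \<open>norm p \<le> d\<close> by simp
  qed
  have "p \<noteq> 0"
    using \<open>f p = 1\<close> scale[of 0 0] by auto
  show ?thesis
  proof (rule that[of "(1 / (norm p)\<^sup>2) *\<^sub>R p"])
    fix y
    have "cinner p (y - f y *\<^sub>C p) = 0"
      using \<open>f p = 1\<close> by (intro orth) (simp add: diff scale)
    then have "cinner (y - f y *\<^sub>C p) p = 0"
      by (simp add: cinner_commute[of "y - f y *\<^sub>C p" p])
    then have "cinner y p = f y * complex_of_real ((norm p)\<^sup>2)"
      by (simp add: cinner_diff_left cinner_scaleC_left cinner_self)
    then show "f y = cinner y ((1 / (norm p)\<^sup>2) *\<^sub>R p)"
      using \<open>p \<noteq> 0\<close> by (simp add: cinner_scaleR_right)
  qed
qed

lemma cinner_left_eqI: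
  assumes "\<And>x. cinner x u = cinner x v"
  shows "u = v"
proof -
  have "cinner (u - v) (u - v) = 0"
    using assms by (simp add: cinner_diff_right)
  then show ?thesis
    by (simp add: cinner_self)
qed

section \<open>Adjoints\<close>

lemma bounded_opsD: "T \<in> bounded_ops \<Longrightarrow> blinfun_apply T (c *\<^sub>C x) = c *\<^sub>C T x"
  by (simp add: bounded_ops_def)

lemma adjoint_exists:
  assumes "T \<in> bounded_ops"
  obtains S where "S \<in> bounded_ops" "\<And>x y. cinner (blinfun_apply T x) y = cinner x (blinfun_apply S y)"
proof -
  have "\<exists>v. \<forall>x. cinner (T x) y = cinner x v" for y
  proof -
    have "cmod (cinner (T x) y) \<le> (norm T * norm y) * norm x" for x
      using norm_cinner_le[of "T x" y] mult_right_mono[OF norm_blinfun[of T x], of "norm y"]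
      by (simp add: algebra_simps)
    then obtain v where "\<And>x. cinner (T x) y = cinner x v"
      using assms
      by (elim riesz_representation[of "\<lambda>x. cinner (T x) y" "norm T * norm y", rotated 2])
        (auto simp: blinfun.add_right cinner_add_left bounded_opsD cinner_scaleC_left)
    then show ?thesis
      by blast
  qed
  then have "\<exists>s. \<forall>y x. cinner (T x) y = cinner x (s y)"
    by (intro choice allI)
  then obtain s where s: "\<And>x y. cinner (T x) y = cinner x (s y)"
    by blast
  have add: "s (y + z) = s y + s z" for y z
    by (rule cinner_left_eqI) (simp add: cinner_add_right flip: s)
  have scale: "s (c *\<^sub>C y) = c *\<^sub>C s y" for c y
    by (rule cinner_left_eqI) (simp add: cinner_scaleC_right flip: s)
  have bound: "norm (s y) \<le> norm y * norm T" for y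
  proof -
    have "norm (s y) * norm (s y) = Re (cinner (T (s y)) y)"
      by (simp add: s cinner_self power2_eq_square)
    also have "\<dots> \<le> norm (T (s y)) * norm y"
      by (rule Re_cinner_le)
    also have "\<dots> \<le> norm (s y) * (norm y * norm T)"
      using mult_right_mono[OF norm_blinfun[of T "s y"], of "norm y"] by (simp add: algebra_simps)
    finally show ?thesis
      by (cases "s y = 0") auto
  qed
  have "bounded_linear s"
    using scale[of "complex_of_real r" for r]
    by (intro bounded_linear_intro[of s "norm T"] add bound) (simp add: scaleC_of_real)
  then have "blinfun_apply (Blinfun s) = s"
    by (rule bounded_linear_Blinfun_apply)
  then show ?thesis
    using that[of "Blinfun s"] s scale by (simp add: bounded_ops_def)
qed

lemma adj_props:
  assumes "T \<in> bounded_ops"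
  shows adj_bounded_ops: "adj T \<in> bounded_ops"
    and cinner_adj: "cinner (T x) y = cinner x (adj T y)"
proof -
  obtain S where S: "S \<in> bounded_ops" "\<And>x y. cinner (T x) y = cinner x (S y)"
    using adjoint_exists[OF assms] by metis
  have "adj T = S"
    unfolding adj_def
  proof (rule the_equality)
    fix R
    assume "\<forall>x y. cinner (T x) y = cinner x (blinfun_apply R y)"
    then show "R = S"
      using S(2) by (intro blinfun_eqI cinner_left_eqI) simp
  qed (use S in blast)
  with S show "adj T \<in> bounded_ops" "cinner (T x) y = cinner x (adj T y)"
    by auto
qed

lemma norm_blinfun_le: "norm T \<le> c \<Longrightarrow> norm (blinfun_apply T x) \<le> c * norm x"
  by (meson mult_right_mono norm_blinfun norm_ge_zero order_trans)

lemma norm_adj_le: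
  assumes "T \<in> bounded_ops"
  shows "norm (adj T) \<le> norm T"
proof (rule norm_blinfun_bound)
  fix y
  have "norm (adj T y) * norm (adj T y) = Re (cinner (T (adj T y)) y)"
    by (simp add: cinner_adj[OF assms] cinner_self power2_eq_square)
  also have "\<dots> \<le> norm (T (adj T y)) * norm y"
    by (rule Re_cinner_le)
  also have "\<dots> \<le> norm (adj T y) * (norm T * norm y)"
    using mult_right_mono[OF norm_blinfun[of T "adj T y"], of "norm y"]
    by (simp add: algebra_simps)
  finally show "norm (adj T y) \<le> norm T * norm y"
    by (cases "adj T y = 0") auto
qed simp

section \<open>Accretive operators\<close>

text \<open>
  \<open>re_ge r T\<close> is the operator inequality \<open>(T + T\<^sup>*) / 2 \<ge> r\<close>, phrased without the adjoint. Accretive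
  operators are those with \<open>re_ge 0\<close>; negative \<open>r\<close> measures how far \<open>T\<close> is from being accretive.
\<close>

definition re_ge :: "real \<Rightarrow> ('h :: complex_hilbert_space \<Rightarrow>\<^sub>L 'h) \<Rightarrow> bool" where
  "re_ge r T \<longleftrightarrow> (\<forall>h. r * (norm h)\<^sup>2 \<le> Re (cinner (T h) h))"

lemma re_ge_0D: "re_ge 0 T \<Longrightarrow> 0 \<le> Re (cinner (T h) h)"
  by (simp add: re_ge_def)

lemma re_ge_norm: "re_ge (- norm T) T"
  unfolding re_ge_def
proof
  fix h
  have "\<bar>Re (cinner (T h) h)\<bar> \<le> norm (T h) * norm h"
    by (rule abs_Re_cinner_le)
  also have "\<dots> \<le> norm T * norm h * norm h"
    by (intro mult_right_mono norm_blinfun) simp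
  finally show "- norm T * (norm h)\<^sup>2 \<le> Re (cinner (T h) h)"
    by (simp add: power2_eq_square mult.assoc)
qed

lemma re_ge_0_sum:
  "finite I \<Longrightarrow> (\<And>i. i \<in> I \<Longrightarrow> re_ge 0 (T i)) \<Longrightarrow> re_ge 0 (\<Sum>i\<in>I. T i)"
  by (auto simp: re_ge_def blinfun.sum_left cinner_sum_left intro: sum_nonneg)

lemma re_ge_unit_sphereI:
  assumes "\<And>h. norm h = 1 \<Longrightarrow> r \<le> Re (cinner (blinfun_apply T h) h)"
  shows "re_ge r T"
  unfolding re_ge_def
proof
  fix h
  show "r * (norm h)\<^sup>2 \<le> Re (cinner (T h) h)"
  proof (cases "h = 0")
    case False
    define u where "u = (1 / norm h) *\<^sub>R h"
    have "norm u = 1" and h: "h = norm h *\<^sub>R u"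
      using False by (simp_all add: u_def)
    have "Re (cinner (T h) h) = (norm h)\<^sup>2 * Re (cinner (T u) u)"
      by (subst (1 2) h)
        (simp add: blinfun.scaleR_right cinner_scaleR_left cinner_scaleR_right power2_eq_square)
    then show ?thesis
      using mult_left_mono[OF assms[OF \<open>norm u = 1\<close>], of "(norm h)\<^sup>2"] by (simp add: mult.commute)
  qed simp
qed

lemma positive_op_add_adj_iff:
  assumes "T \<in> bounded_ops"
  shows "positive_op (T + adj T) \<longleftrightarrow> re_ge 0 T"
proof -
  have "cinner ((T + adj T) h) h = complex_of_real (2 * Re (cinner (T h) h))" for h
  proof -
    have "cinner ((T + adj T) h) h = cinner (T h) h + cnj (cinner (T h) h)"
      using cinner_adj[OF assms, of h h] cinner_commute[of "adj T h" h]
      by (simp add: blinfun.add_left cinner_add_left)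
    then show ?thesis
      by (simp add: complex_add_cnj)
  qed
  moreover have "T + adj T \<in> bounded_ops"
    using assms adj_bounded_ops[OF assms]
    by (simp add: bounded_ops_def blinfun.add_left scaleC_add_right)
  ultimately show ?thesis
    by (simp add: positive_op_def re_ge_def complex_nonneg_Reals_iff)
qed

lemma frak_r_iff:
  assumes "A \<subseteq> bounded_ops"
  shows "a \<in> frak_r A \<longleftrightarrow> a \<in> A \<and> re_ge 0 a"
  using assms positive_op_add_adj_iff[of a] by (auto simp: frak_r_def)

lemma closed_re_ge_0: "closed {T :: 'h :: complex_hilbert_space \<Rightarrow>\<^sub>L 'h. re_ge 0 T}"
proof -
  have bl: "bounded_linear (\<lambda>T. Re (cinner (blinfun_apply T h) h))" for h :: 'h
  proof (rule bounded_linear_intro[where K = "norm h * norm h"])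
    fix T :: "'h \<Rightarrow>\<^sub>L 'h"
    show "norm (Re (cinner (blinfun_apply T h) h)) \<le> norm T * (norm h * norm h)"
      using abs_Re_cinner_le[of "T h" h] mult_right_mono[OF norm_blinfun[of T h], of "norm h"]
      by simp
  qed (simp_all add: blinfun.add_left blinfun.scaleR_left cinner_add_left cinner_scaleR_left)
  have "{T :: 'h \<Rightarrow>\<^sub>L 'h. re_ge 0 T} = (\<Inter>h. {T. 0 \<le> Re (cinner (blinfun_apply T h) h)})"
    by (auto simp: re_ge_def)
  moreover have "closed {T. 0 \<le> Re (cinner (blinfun_apply T h) h)}" for h :: 'h
    by (intro closed_Collect_le continuous_on_const linear_continuous_on bl)
  ultimately show ?thesis
    by auto
qed

text \<open>
  Expanding \<open>(1 - z)\<^sup>* (1 - z) \<le> 1\<close> gives \<open>z\<^sup>* z \<le> z + z\<^sup>*\<close>. The same holds for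
  \<open>z\<^sup>*\<close>, since \<open>1 - z\<^sup>*\<close> is a contraction too.
\<close>

lemma norm_sq_le_of_norm_id_minus_le_1:
  assumes "norm (id_blinfun - z) \<le> 1"
  shows "(norm (z h))\<^sup>2 \<le> 2 * Re (cinner (z h) h)"
proof -
  have "norm (h - z h) \<le> norm h"
    using norm_blinfun_le[OF assms, of h] by (simp add: blinfun.diff_left)
  then have "(norm (h - z h))\<^sup>2 \<le> (norm h)\<^sup>2"
    by (simp add: power_mono)
  then show ?thesis
    by (simp add: norm_diff_squared Re_cinner_commute[of h])
qed

lemma norm_adj_sq_le_of_norm_id_minus_le_1:
  assumes z: "z \<in> bounded_ops" and le: "norm (id_blinfun - z) \<le> 1"
  shows "(norm (adj z h))\<^sup>2 \<le> 2 * Re (cinner (z h) h)"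
proof -
  have b: "id_blinfun - z \<in> bounded_ops"
    using z by (simp add: bounded_ops_def blinfun.diff_left complex_vector.scale_right_diff_distrib)
  have "adj (id_blinfun - z) = id_blinfun - adj z"
    by (intro blinfun_eqI cinner_left_eqI)
      (simp add: cinner_adj[OF z] cinner_diff_right blinfun.diff_left
        cinner_diff_left flip: cinner_adj[OF b])
  then have "norm (id_blinfun - adj z) \<le> 1"
    using norm_adj_le[OF b] le by simp
  from norm_sq_le_of_norm_id_minus_le_1[OF this, of h] show ?thesis
    by (simp add: Re_cinner_commute[of "adj z h"] flip: cinner_adj[OF z])
qed

text \<open>
  By Cauchy--Schwarz \<open>|\<langle>x a y h, h\<rangle>| \<le> \<parallel>a\<parallel> \<parallel>y h\<parallel> \<parallel>x\<^sup>* h\<parallel>\<close>, and the right-hand side is at most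
  \<open>\<parallel>a\<parallel> (\<parallel>y h\<parallel>\<^sup>2 + \<parallel>x\<^sup>* h\<parallel>\<^sup>2) / 2 \<le> \<parallel>a\<parallel> Re \<langle>(x + y) h, h\<rangle>\<close>. So a multiple of \<open>x + y\<close> absorbs
  the sandwiched term, whatever the sign of the latter.
\<close>

lemma re_ge_0_scaled_sum_plus_sandwich:
  assumes x: "x \<in> bounded_ops" "norm (id_blinfun - x) \<le> 1"
    and y: "norm (id_blinfun - y) \<le> 1"
  shows "re_ge 0 (norm a *\<^sub>R (x + y) + (x o\<^sub>L a o\<^sub>L y))"
  unfolding re_ge_def
proof
  fix h
  have "\<bar>Re (cinner ((x o\<^sub>L a o\<^sub>L y) h) h)\<bar> = \<bar>Re (cinner (a (y h)) (adj x h))\<bar>"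
    by (simp add: cinner_adj[OF x(1)])
  also have "\<dots> \<le> norm (a (y h)) * norm (adj x h)"
    by (rule abs_Re_cinner_le)
  also have "\<dots> \<le> norm a * (norm (y h) * norm (adj x h))"
    using mult_right_mono[OF norm_blinfun[of a "y h"], of "norm (adj x h)"] by (simp add: mult.assoc)
  also have "\<dots> \<le> norm a * (((norm (y h))\<^sup>2 + (norm (adj x h))\<^sup>2) / 2)"
    using sum_squares_bound[of "norm (y h)" "norm (adj x h)"] by (intro mult_left_mono) auto
  also have "\<dots> \<le> norm a * (Re (cinner (y h) h) + Re (cinner (x h) h))"
    using norm_sq_le_of_norm_id_minus_le_1[OF y, of h]
      norm_adj_sq_le_of_norm_id_minus_le_1[OF x, of h]
    by (intro mult_left_mono) auto
  finally show "0 * (norm h)\<^sup>2 \<le> Re (cinner ((norm a *\<^sub>R (x + y) + (x o\<^sub>L a o\<^sub>L y)) h) h)"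
    by (simp add: blinfun.add_left blinfun.scaleR_left cinner_add_left cinner_scaleR_left
        algebra_simps abs_if split: if_splits)
qed

section \<open>Complex subspaces and closed spans\<close>

lemma scaleR_mem_subspace: "complex_vector.subspace V \<Longrightarrow> x \<in> V \<Longrightarrow> r *\<^sub>R x \<in> V"
  by (simp add: complex_vector.subspace_scale flip: scaleC_of_real)

lemma subspace_closure:
  fixes V :: "'a :: complex_normed_vector set"
  assumes "complex_vector.subspace V"
  shows "complex_vector.subspace (closure V)"
proof (rule complex_vector.subspaceI)
  show "0 \<in> closure V"
    using complex_vector.subspace_0[OF assms] closure_subset by blast
next
  fix x y
  assume "x \<in> closure V" "y \<in> closure V"
  then obtain f g where "\<And>n. f n \<in> V" "f \<longlonglongrightarrow> x" "\<And>n. g n \<in> V" "g \<longlonglongrightarrow> y"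
    unfolding closure_sequential by blast
  then show "x + y \<in> closure V"
    unfolding closure_sequential using complex_vector.subspace_add[OF assms]
    by (intro exI[of _ "\<lambda>n. f n + g n"]) (auto intro: tendsto_add)
next
  fix c x
  assume "x \<in> closure V"
  then obtain f where "\<And>n. f n \<in> V" "f \<longlonglongrightarrow> x"
    unfolding closure_sequential by blast
  then show "c *\<^sub>C x \<in> closure V"
    unfolding closure_sequential using complex_vector.subspace_scale[OF assms]
    by (intro exI[of _ "\<lambda>n. c *\<^sub>C f n"])
      (auto intro: bounded_linear.tendsto[OF bounded_linear_scaleC])
qed

lemma closed_span_subspace: "complex_vector.subspace (closed_span S)"
  unfolding closed_span_def by (intro subspace_closure complex_vector.subspace_span)

lemma closed_span_superset: "S \<subseteq> closed_span S"
  unfolding closed_span_def using complex_vector.span_superset closure_subset by blast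

lemma closed_span_minimal:
  "S \<subseteq> V \<Longrightarrow> complex_vector.subspace V \<Longrightarrow> closed V \<Longrightarrow> closed_span S \<subseteq> V"
  unfolding closed_span_def by (intro closure_minimal complex_vector.span_minimal)

lemma closed_closed_span: "closed (closed_span S)"
  by (simp add: closed_span_def)

section \<open>The unit of the unitization\<close>

lemma operator_algebraD:
  assumes "operator_algebra A"
  shows "A \<subseteq> bounded_ops" "complex_vector.subspace A" "closed A"
    "S \<in> A \<Longrightarrow> T \<in> A \<Longrightarrow> S o\<^sub>L T \<in> A"
  using assms by (auto simp: operator_algebra_def)

lemma unit_of_eqI:
  assumes "is_identity (unitization A) e"
  shows "unit_of A = e"
  unfolding unit_of_def
proof (rule the_equality)
  fix e'
  assume "is_identity (unitization A) e'"
  then have "e' = e o\<^sub>L e'" "e = e o\<^sub>L e'"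
    using assms unfolding is_identity_def by metis+
  then show "e' = e" by simp
qed (rule assms)

text \<open>
  Unless \<open>A\<close> has an identity of norm one, which need not be the identity operator, the unitization
  contains the latter as \<open>0 + 1\<close>.
\<close>

lemma unit_of_cases:
  assumes "operator_algebra A"
  obtains "unit_of A = id_blinfun"
  | "is_identity A (unit_of A)" "norm (unit_of A) = 1"
proof (cases "\<exists>e. is_identity A e \<and> norm e = 1")
  case True
  then obtain e where e: "is_identity A e" "norm e = 1" by blast
  then have "unit_of A = e"
    by (intro unit_of_eqI) (auto simp: unitization_def)
  with e that(2) show ?thesis by simp
next
  case False
  have "id_blinfun = 0 + 1 *\<^sub>C id_blinfun"
    by (simp add: scaleC_one)
  then have "id_blinfun \<in> unitization A"
    using False complex_vector.subspace_0[OF operator_algebraD(2)[OF assms]]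
    unfolding unitization_def by (simp only: if_False) blast
  then have "is_identity (unitization A) id_blinfun"
    by (auto simp: is_identity_def intro: blinfun_eqI)
  then show ?thesis
    using unit_of_eqI that(1) by blast
qed

text \<open>
  For \<open>r\<close> in the range and \<open>k\<close> in the kernel of \<open>e\<close>, \<open>r = e (r + c k)\<close> is no longer than \<open>r + c k\<close>.
\<close>

lemma contractive_idempotent_orthogonal:
  assumes e: "e \<in> bounded_ops" "e o\<^sub>L e = e" "norm e \<le> 1"
  shows "cinner (e g) (h - e h) = 0"
proof (rule orthogonal_if_norm_minimal)
  fix c
  have ee: "e (e k) = e k" for k
    using e(2) by (metis blinfun_apply_blinfun_compose)
  have "e g = e (e g + c *\<^sub>C (h - e h))"
    by (simp add: blinfun.add_right blinfun.diff_right bounded_opsD[OF e(1)] ee)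
  then show "norm (e g) \<le> norm (e g + c *\<^sub>C (h - e h))"
    using norm_blinfun_le[OF e(3), of "e g + c *\<^sub>C (h - e h)"] by simp
qed

text \<open>
  A unit \<open>e\<close> of norm one in \<open>A\<close> is an orthogonal projection with \<open>x = e x e\<close>, so that \<open>1 - x\<close> is the
  orthogonal sum of \<open>e - x\<close> and \<open>1 - e\<close>. The unit of the unitization may thus be replaced by the
  identity operator.
\<close>

lemma frak_F_iff:
  assumes A: "operator_algebra A"
  shows "x \<in> frak_F A \<longleftrightarrow> x \<in> A \<and> norm (id_blinfun - x) \<le> 1"
proof (cases rule: unit_of_cases[OF A])
  case 1
  then show ?thesis
    by (simp add: frak_F_def)
next
  case 2
  define e where "e = unit_of A"
  have e: "e \<in> bounded_ops" "e o\<^sub>L e = e" "norm e \<le> 1"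
    and id: "\<And>a. a \<in> A \<Longrightarrow> e o\<^sub>L a = a" "\<And>a. a \<in> A \<Longrightarrow> a o\<^sub>L e = a"
    using 2 operator_algebraD(1)[OF A] by (auto simp: e_def is_identity_def)
  have "norm (e - x) \<le> 1 \<longleftrightarrow> norm (id_blinfun - x) \<le> 1" if "x \<in> A"
  proof
    assume "norm (id_blinfun - x) \<le> 1"
    have "e (x h) = x h" for h
      using id(1)[OF that] by (metis blinfun_apply_blinfun_compose)
    then have "e - x = e o\<^sub>L (id_blinfun - x)"
      by (intro blinfun_eqI) (simp add: blinfun.diff_left blinfun.diff_right)
    then have "norm (e - x) \<le> norm e * norm (id_blinfun - x)"
      by (simp add: norm_blinfun_compose)
    also have "\<dots> \<le> 1"
      using e(3) \<open>norm (id_blinfun - x) \<le> 1\<close> by (simp add: mult_le_one)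
    finally show "norm (e - x) \<le> 1" .
  next
    assume le: "norm (e - x) \<le> 1"
    show "norm (id_blinfun - x) \<le> 1"
    proof (rule norm_blinfun_bound)
      fix h
      have xe: "x (e h) = x h" and ex: "e (x h) = x h" and ee: "e (e h) = e h"
        using id[OF that] e(2) by (metis blinfun_apply_blinfun_compose)+
      \<comment> \<open>Pythagoras for \<open>h - x h = (h - e h) + (e h - x h)\<close>, the second summand in the
        range of \<open>e\<close>.\<close>
      have range: "e h - x h = e (e h - x h)"
        by (simp add: blinfun.diff_right ee ex)
      have "cinner (e h - x h) (h - e h) = 0"
        by (subst range) (rule contractive_idempotent_orthogonal[OF e])
      then have "(norm ((e h - x h) + (h - e h)))\<^sup>2 = (norm (e h - x h))\<^sup>2 + (norm (h - e h))\<^sup>2"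
        by (simp only: norm_add_squared) simp
      also have "\<dots> \<le> (norm (e h))\<^sup>2 + (norm (h - e h))\<^sup>2"
        using norm_blinfun_le[OF le, of "e h"] by (simp add: blinfun.diff_left ee xe power_mono)
      also have "\<dots> = (norm (e h + (h - e h)))\<^sup>2"
        by (simp only: norm_add_squared contractive_idempotent_orthogonal[OF e]) simp
      finally have "(norm (h - x h))\<^sup>2 \<le> (norm h)\<^sup>2"
        by simp
      then show "norm ((id_blinfun - x) h) \<le> 1 * norm h"
        by (simp add: blinfun.diff_left power2_le_iff_abs_le)
    qed simp
  qed
  then show ?thesis
    by (auto simp: frak_F_def e_def)
qed

section \<open>Resolvents of accretive operators\<close>

text \<open>
  The element is \<open>x = a (a + \<mu>)\<^bsup>-1\<^esup>\<close>, so that \<open>1 - x = \<mu> (a + \<mu>)\<^bsup>-1\<^esup>\<close>. That it lies in the possibly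
  nonunital algebra \<open>A\<close> comes from how it is found: with \<open>T = 1 - t (a + \<mu>)\<close>, the equation
  \<open>x (a + \<mu>) = a\<close> reads \<open>x = x T + t a\<close>, the right-hand side maps the commutant of \<open>a\<close> in \<open>A\<close> to
  itself, and \<open>\<parallel>T\<parallel> < 1\<close> for small \<open>t\<close> because \<open>a\<close> is accretive. The two equations in the conclusion say
  that \<open>x\<close> is an approximate identity for \<open>a\<close> as \<open>\<mu>\<close> tends to zero.
\<close>

lemma accretive_resolvent:
  assumes A: "operator_algebra A" and a: "a \<in> A" "re_ge 0 a" and "\<mu> > 0"
  obtains x where "x \<in> A" "norm x \<le> 1" "norm (id_blinfun - x) \<le> 1"
    "a - (a o\<^sub>L x) = \<mu> *\<^sub>R x" "a - (x o\<^sub>L a) = \<mu> *\<^sub>R x"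
proof -
  define q where "q = \<mu>\<^sup>2 + (norm a)\<^sup>2"
  \<comment> \<open>The step size that minimises the bound \<open>(1 - t \<mu>)\<^sup>2 + t\<^sup>2 \<parallel>a\<parallel>\<^sup>2\<close>.\<close>
  define t where "t = \<mu> / q"
  define c where "c = norm a / sqrt q"
  have "q > 0" "t > 0" "c \<ge> 0"
    using \<open>\<mu> > 0\<close> by (auto simp: q_def t_def c_def add_pos_nonneg)
  have "c < 1"
    using \<open>q > 0\<close> \<open>\<mu> > 0\<close> by (auto simp: c_def q_def intro: real_less_rsqrt)
  have tmu: "0 \<le> 1 - t * \<mu>"
    using \<open>q > 0\<close> by (simp add: t_def q_def power2_eq_square)
  have c_sq: "(1 - t * \<mu>)\<^sup>2 + t\<^sup>2 * (norm a)\<^sup>2 = c\<^sup>2"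
  proof -
    have "(1 - t * \<mu>)\<^sup>2 + t\<^sup>2 * (norm a)\<^sup>2 = 1 - 2 * t * \<mu> + t\<^sup>2 * q"
      by (simp add: q_def power2_eq_square algebra_simps)
    also have "\<dots> = (q - \<mu>\<^sup>2) / q"
      using \<open>q > 0\<close> by (simp add: t_def power2_eq_square field_simps)
    also have "\<dots> = c\<^sup>2"
      using \<open>q > 0\<close> by (simp add: c_def q_def power_divide)
    finally show ?thesis .
  qed
  define T where "T = id_blinfun - t *\<^sub>R (a + \<mu> *\<^sub>R id_blinfun)"
  have "norm T \<le> c"
  proof (rule norm_blinfun_bound)
    fix h
    have "T h = (1 - t * \<mu>) *\<^sub>R h - t *\<^sub>R a h"
      by (simp add: T_def blinfun.diff_left blinfun.scaleR_left blinfun.add_left algebra_simps)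
    then have "(norm (T h))\<^sup>2 = (1 - t * \<mu>)\<^sup>2 * (norm h)\<^sup>2
        - 2 * ((1 - t * \<mu>) * t * Re (cinner (a h) h)) + t\<^sup>2 * (norm (a h))\<^sup>2"
      by (simp add: norm_diff_squared cinner_scaleR_left cinner_scaleR_right power_mult_distrib
          Re_cinner_commute[of h])
    also have "\<dots> \<le> (1 - t * \<mu>)\<^sup>2 * (norm h)\<^sup>2 + t\<^sup>2 * (norm a * norm h)\<^sup>2"
    proof -
      have "0 \<le> (1 - t * \<mu>) * t * Re (cinner (a h) h)"
        using tmu \<open>t > 0\<close> re_ge_0D[OF a(2)] by simp
      moreover have "t\<^sup>2 * (norm (a h))\<^sup>2 \<le> t\<^sup>2 * (norm a * norm h)\<^sup>2"
        by (intro mult_left_mono power_mono norm_blinfun) auto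
      ultimately show ?thesis by linarith
    qed
    also have "\<dots> = (c * norm h)\<^sup>2"
      by (simp add: power_mult_distrib distrib_right flip: c_sq)
    finally show "norm (T h) \<le> c * norm h"
      by (rule power2_le_imp_le) (simp add: \<open>c \<ge> 0\<close>)
  qed (rule \<open>c \<ge> 0\<close>)
  define F where "F x = x - t *\<^sub>R ((x o\<^sub>L a) + \<mu> *\<^sub>R x) + t *\<^sub>R a" for x
  define B where "B = {x \<in> A. x o\<^sub>L a = a o\<^sub>L x}"
  note sub = operator_algebraD(2)[OF A]
  have "\<exists>!x\<in>B. F x = x"
  proof (rule Banach_fix)
    have "closed {x. x o\<^sub>L a = a o\<^sub>L x}"
      by (intro closed_Collect_eq continuous_intros
          bounded_linear.continuous_on[OF bounded_bilinear.bounded_linear_left]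
          bounded_linear.continuous_on[OF bounded_bilinear.bounded_linear_right]
          bounded_bilinear_blinfun_compose)
    moreover have "B = A \<inter> {x. x o\<^sub>L a = a o\<^sub>L x}"
      by (auto simp: B_def)
    ultimately show "complete B"
      using operator_algebraD(3)[OF A] by (simp add: complete_eq_closed closed_Int)
    have "a \<in> B"
      using a by (simp add: B_def)
    then show "B \<noteq> {}"
      by blast
    show "0 \<le> c" "c < 1" by fact+
    show "F ` B \<subseteq> B"
    proof
      fix y
      assume "y \<in> F ` B"
      then obtain x where x: "x \<in> A" "x o\<^sub>L a = a o\<^sub>L x" "y = F x"
        by (auto simp: B_def)
      have "F x \<in> A"
        unfolding F_def
        using operator_algebraD(4)[OF A x(1) a(1)] x(1) a(1)
        by (intro complex_vector.subspace_add complex_vector.subspace_diff scaleR_mem_subspace sub)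
      moreover have "x (a h) = a (x h)" for h
        using x(2) by (metis blinfun_apply_blinfun_compose)
      then have "F x o\<^sub>L a = a o\<^sub>L F x"
        by (intro blinfun_eqI)
          (simp add: F_def blinfun.add_left blinfun.diff_left blinfun.scaleR_left
            blinfun.add_right blinfun.diff_right blinfun.scaleR_right)
      ultimately show "y \<in> B"
        by (simp add: B_def x(3))
    qed
    fix x y
    have "F x - F y = (x - y) o\<^sub>L T"
      by (intro blinfun_eqI)
        (simp add: F_def T_def blinfun.add_left blinfun.diff_left blinfun.scaleR_left
            blinfun.add_right blinfun.diff_right blinfun.scaleR_right algebra_simps)
    then have "dist (F x) (F y) \<le> norm (x - y) * norm T"
      by (simp add: dist_norm norm_blinfun_compose)
    also have "\<dots> \<le> norm (x - y) * c"
      using \<open>norm T \<le> c\<close> by (rule mult_left_mono) simp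
    finally show "dist (F x) (F y) \<le> c * dist x y"
      by (simp add: dist_norm mult.commute)
  qed
  then obtain x where x: "x \<in> A" "x o\<^sub>L a = a o\<^sub>L x" "F x = x"
    by (auto simp: B_def)
  have "t *\<^sub>R (a - ((x o\<^sub>L a) + \<mu> *\<^sub>R x)) = 0"
    using x(3) by (simp add: F_def scaleR_diff_right)
  then have "a - ((x o\<^sub>L a) + \<mu> *\<^sub>R x) = 0"
    using \<open>t > 0\<close> by (metis less_irrefl scaleR_eq_0_iff)
  then have xa: "a - (x o\<^sub>L a) = \<mu> *\<^sub>R x"
    by (simp add: algebra_simps)
  then have ax: "a - (a o\<^sub>L x) = \<mu> *\<^sub>R x"
    by (simp add: x(2))
  define y where "y = id_blinfun - x"
  have res: "a (y h) = \<mu> *\<^sub>R x h" "a (y h) + \<mu> *\<^sub>R y h = \<mu> *\<^sub>R h" for h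
  proof -
    have "a (y h) = (a - (a o\<^sub>L x)) h"
      by (simp add: y_def blinfun.diff_left blinfun.diff_right)
    then show "a (y h) = \<mu> *\<^sub>R x h"
      by (simp add: ax blinfun.scaleR_left)
    then show "a (y h) + \<mu> *\<^sub>R y h = \<mu> *\<^sub>R h"
      by (simp add: y_def blinfun.diff_left scaleR_diff_right)
  qed
  \<comment> \<open>Accretivity of \<open>a\<close> makes both terms of \<open>\<mu> h = a y h + \<mu> y h\<close> no longer than the sum.\<close>
  have "(norm (a (y h)))\<^sup>2 + (norm (\<mu> *\<^sub>R y h))\<^sup>2 \<le> (\<mu> * norm h)\<^sup>2" for h
  proof -
    have "(\<mu> * norm h)\<^sup>2 = (norm (a (y h) + \<mu> *\<^sub>R y h))\<^sup>2"
      using \<open>\<mu> > 0\<close> by (simp add: res(2))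
    also have "\<dots> = (norm (a (y h)))\<^sup>2 + 2 * (\<mu> * Re (cinner (a (y h)) (y h)))
        + (norm (\<mu> *\<^sub>R y h))\<^sup>2"
      unfolding norm_add_squared by (simp add: cinner_scaleR_right)
    finally show ?thesis
      using re_ge_0D[OF a(2), of "y h"] \<open>\<mu> > 0\<close> by simp
  qed
  then have short: "(\<mu> * norm (x h))\<^sup>2 + (\<mu> * norm (y h))\<^sup>2 \<le> (\<mu> * norm h)\<^sup>2" for h
    using \<open>\<mu> > 0\<close> by (simp add: res(1) power_mult_distrib)
  have "norm (x h) \<le> 1 * norm h" "norm (y h) \<le> 1 * norm h" for h
  proof -
    have "(\<mu> * norm (x h))\<^sup>2 \<le> (\<mu> * norm h)\<^sup>2" "(\<mu> * norm (y h))\<^sup>2 \<le> (\<mu> * norm h)\<^sup>2"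
      using short[of h] zero_le_power2[of "\<mu> * norm (x h)"] zero_le_power2[of "\<mu> * norm (y h)"]
      by linarith+
    then show "norm (x h) \<le> 1 * norm h" "norm (y h) \<le> 1 * norm h"
      using \<open>\<mu> > 0\<close> by (auto dest!: power2_le_imp_le)
  qed
  then have "norm x \<le> 1" "norm y \<le> 1"
    by (auto intro: norm_blinfun_bound)
  then show ?thesis
    using that[OF x(1) _ _ ax xa] by (simp add: y_def)
qed

section \<open>The closed span of the accretive elements\<close>

text \<open>
  Each generator \<open>x a y\<close> is half the difference of the accretive elements \<open>\<parallel>a\<parallel> (x + y) \<plusminus> x a y\<close>.
\<close>

lemma sub_H_subset_closed_span_frak_r:
  assumes A: "operator_algebra A"
  shows "sub_H A \<subseteq> closed_span (frak_r A)"
  unfolding sub_H_def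
proof (rule closed_span_minimal[OF _ closed_span_subspace closed_closed_span], safe)
  fix x a y
  assume xay: "x \<in> frak_F A" "a \<in> A" "y \<in> frak_F A"
  then have x: "x \<in> A" "x \<in> bounded_ops" "norm (id_blinfun - x) \<le> 1"
    and y: "y \<in> A" "norm (id_blinfun - y) \<le> 1"
    using operator_algebraD(1)[OF A] by (auto simp: frak_F_iff[OF A])
  note sub = operator_algebraD(2)[OF A]
  define p where "p b = norm b *\<^sub>R (x + y) + (x o\<^sub>L b o\<^sub>L y)" for b
  have p: "p b \<in> closed_span (frak_r A)" if "b \<in> A" for b
  proof -
    have "p b \<in> A"
      unfolding p_def using x y that operator_algebraD(4)[OF A]
      by (intro complex_vector.subspace_add scaleR_mem_subspace sub) auto
    moreover have "re_ge 0 (p b)"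
      unfolding p_def using x y by (intro re_ge_0_scaled_sum_plus_sandwich)
    ultimately show ?thesis
      using closed_span_superset frak_r_iff[OF operator_algebraD(1)[OF A]] by blast
  qed
  have "- a \<in> A"
    using xay(2) sub complex_vector.subspace_neg by blast
  have "x o\<^sub>L a o\<^sub>L y = (1 / 2) *\<^sub>R (p a - p (- a))"
    by (intro blinfun_eqI)
      (simp add: p_def blinfun.diff_left blinfun.add_left blinfun.scaleR_left
        blinfun.minus_left blinfun.minus_right flip: scaleR_2)
  then show "x o\<^sub>L a o\<^sub>L y \<in> closed_span (frak_r A)"
    using p[OF xay(2)] p[OF \<open>- a \<in> A\<close>]
    by (auto intro!: scaleR_mem_subspace complex_vector.subspace_diff closed_span_subspace)
qed

text \<open>
  With \<open>x = a (a + \<mu>)\<^bsup>-1\<^esup>\<close>, which lies in \<open>\<FF>\<^sub>A\<close>, the products \<open>x a x\<close> tend to \<open>a\<close> as \<open>\<mu>\<close> tends to zero.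
\<close>

lemma frak_r_subset_sub_H:
  assumes A: "operator_algebra A"
  shows "frak_r A \<subseteq> sub_H A"
proof
  fix a
  assume "a \<in> frak_r A"
  then have a: "a \<in> A" "re_ge 0 a"
    by (auto simp: frak_r_iff[OF operator_algebraD(1)[OF A]])
  have "\<exists>b\<in>sub_H A. dist b a < e" if "e > 0" for e
  proof -
    define \<mu> where "\<mu> = e / 3"
    have "\<mu> > 0"
      using that by (simp add: \<mu>_def)
    from accretive_resolvent[OF A a this] obtain x
      where x: "x \<in> A" "norm x \<le> 1" "norm (id_blinfun - x) \<le> 1"
        "a - (a o\<^sub>L x) = \<mu> *\<^sub>R x" "a - (x o\<^sub>L a) = \<mu> *\<^sub>R x"
      by metis
    have "x o\<^sub>L a o\<^sub>L x \<in> sub_H A"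
      unfolding sub_H_def using x a
      by (intro set_mp[OF closed_span_superset]) (auto simp: frak_F_iff[OF A])
    moreover have "a - (x o\<^sub>L a o\<^sub>L x) = (a - (x o\<^sub>L a)) + (x o\<^sub>L (a - (a o\<^sub>L x)))"
      by (intro blinfun_eqI) (simp add: blinfun.diff_left blinfun.add_left blinfun.diff_right)
    then have "norm (a - (x o\<^sub>L a o\<^sub>L x)) \<le> norm (\<mu> *\<^sub>R x) + norm (x o\<^sub>L (\<mu> *\<^sub>R x))"
      unfolding x(4,5) by (metis norm_triangle_ineq)
    moreover have "norm (x o\<^sub>L (\<mu> *\<^sub>R x)) \<le> norm x * norm (\<mu> *\<^sub>R x)"
      by (rule norm_blinfun_compose)
    moreover have "norm (\<mu> *\<^sub>R x) \<le> \<mu>"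
      using x(2) \<open>\<mu> > 0\<close> by simp
    moreover have "norm x * norm (\<mu> *\<^sub>R x) \<le> norm (\<mu> *\<^sub>R x)"
      using x(2) by (intro mult_left_le_one_le) auto
    ultimately have "x o\<^sub>L a o\<^sub>L x \<in> sub_H A" "norm (a - (x o\<^sub>L a o\<^sub>L x)) \<le> 2 * \<mu>"
      by linarith+
    moreover have "2 * \<mu> < e"
      using that by (simp add: \<mu>_def)
    ultimately show ?thesis
      by (intro bexI[of _ "x o\<^sub>L a o\<^sub>L x"]) (auto simp: dist_norm norm_minus_commute)
  qed
  then have "a \<in> closure (sub_H A)"
    by (simp add: closure_approachable)
  then show "a \<in> sub_H A"
    using closed_closed_span closure_closed unfolding sub_H_def by blast
qed

lemma sub_H_subset:
  assumes A: "operator_algebra A"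
  shows "sub_H A \<subseteq> A"
  unfolding sub_H_def
  using operator_algebraD(4)[OF A]
  by (intro closed_span_minimal operator_algebraD(2,3)[OF A]) (auto simp: frak_F_iff[OF A])

lemma sub_H_eq_closed_span_frak_r:
  assumes A: "operator_algebra A"
  shows "sub_H A = closed_span (frak_r A)"
proof
  show "closed_span (frak_r A) \<subseteq> sub_H A"
    using frak_r_subset_sub_H[OF A] closed_span_subspace closed_closed_span
    unfolding sub_H_def by (intro closed_span_minimal)
qed (rule sub_H_subset_closed_span_frak_r[OF A])

lemma frak_r_sub_H:
  assumes A: "operator_algebra A"
  shows "frak_r (sub_H A) = frak_r A"
  using frak_r_subset_sub_H[OF A] sub_H_subset[OF A] by (auto simp: frak_r_def)

section \<open>Contractive units for finitely many elements\<close>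

text \<open>
  The sum \<open>a\<close> of the finite set dominates each summand \<open>f\<close> in the sense that \<open>Re f \<le> Re a\<close>, while
  \<open>f\<^sup>* f\<close> and \<open>f f\<^sup>*\<close> are at most \<open>2 Re f\<close>. Hence for \<open>y = 1 - x = \<mu> (a + \<mu>)\<^bsup>-1\<^esup>\<close> the operator
  \<open>y\<^sup>* f\<^sup>* f y\<close> is at most \<open>2 Re (y\<^sup>* a y)\<close>, whose norm is at most \<open>2 \<parallel>a y\<parallel> = 2 \<mu> \<parallel>x\<parallel>\<close>; the products
  \<open>y f\<close> are treated in the same way through their adjoints. So \<open>x\<close> almost fixes all members of the set at once.
\<close>

lemma frak_F_finite_approximate_unit:
  assumes A: "operator_algebra A" and F: "finite F" "F \<subseteq> frak_F A" and "\<epsilon> > 0"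
  obtains e where "e \<in> A" "norm e \<le> 1"
    "\<And>f. f \<in> F \<Longrightarrow> norm ((e o\<^sub>L f) - f) < \<epsilon>" "\<And>f. f \<in> F \<Longrightarrow> norm ((f o\<^sub>L e) - f) < \<epsilon>"
proof -
  have F': "f \<in> A" "f \<in> bounded_ops" "norm (id_blinfun - f) \<le> 1" if "f \<in> F" for f
  proof -
    have "f \<in> frak_F A"
      using that F(2) by blast
    then show "f \<in> A" "f \<in> bounded_ops" "norm (id_blinfun - f) \<le> 1"
      using operator_algebraD(1)[OF A] by (auto simp: frak_F_iff[OF A])
  qed
  define a where "a = \<Sum>F"
  have re: "0 \<le> Re (cinner (f h) h)" if "f \<in> F" for f h
    using norm_sq_le_of_norm_id_minus_le_1[OF F'(3)[OF that], of h]
      zero_le_power2[of "norm (f h)"] by linarith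
  have "a \<in> A"
    unfolding a_def using F' by (intro complex_vector.subspace_sum operator_algebraD(2)[OF A])
  moreover have "re_ge 0 a"
    unfolding a_def using re by (intro re_ge_0_sum F(1)) (simp add: re_ge_def)
  ultimately have a: "a \<in> A" "re_ge 0 a" .
  have dom: "Re (cinner (f h) h) \<le> Re (cinner (a h) h)" if "f \<in> F" for f h
    unfolding a_def blinfun.sum_left cinner_sum_left Re_sum
    using that F(1) re by (intro member_le_sum) auto
  define \<mu> where "\<mu> = \<epsilon>\<^sup>2 / 8"
  have "\<mu> > 0"
    using \<open>\<epsilon> > 0\<close> by (simp add: \<mu>_def)
  from accretive_resolvent[OF A a this] obtain x
    where x: "x \<in> A" "norm x \<le> 1" "norm (id_blinfun - x) \<le> 1"
      "a - (a o\<^sub>L x) = \<mu> *\<^sub>R x" "a - (x o\<^sub>L a) = \<mu> *\<^sub>R x"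
    by metis
  define y where "y = id_blinfun - x"
  have y: "y \<in> bounded_ops" "norm y \<le> 1"
    using x operator_algebraD(1)[OF A]
    by (auto simp: y_def bounded_ops_def blinfun.diff_left complex_vector.scale_right_diff_distrib)
  have "a o\<^sub>L y = a - (a o\<^sub>L x)" "y o\<^sub>L a = a - (x o\<^sub>L a)"
    by (intro blinfun_eqI; simp add: y_def blinfun.diff_left blinfun.diff_right)+
  then have ay: "a o\<^sub>L y = \<mu> *\<^sub>R x" "y o\<^sub>L a = \<mu> *\<^sub>R x"
    by (simp_all only: x(4,5))
  have small: "norm (f (y h)) \<le> \<epsilon> / 2 * norm h" "norm (adj f (adj y h)) \<le> \<epsilon> / 2 * norm h"
    if f: "f \<in> F" for f h
  proof -
    have mx: "norm ((\<mu> *\<^sub>R x) k) \<le> \<mu> * norm k" for k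
      using x(2) \<open>\<mu> > 0\<close> by (intro norm_blinfun_le) simp
    have sq: "2 * (\<mu> * norm h * norm h) = (\<epsilon> / 2 * norm h)\<^sup>2"
      by (simp add: \<mu>_def power2_eq_square)
    have "(norm (f (y h)))\<^sup>2 \<le> 2 * Re (cinner (a (y h)) (y h))"
      using norm_sq_le_of_norm_id_minus_le_1[OF F'(3)[OF f], of "y h"] dom[OF f, of "y h"] by simp
    also have "\<dots> = 2 * Re (cinner ((\<mu> *\<^sub>R x) h) (y h))"
      by (simp only: blinfun_apply_blinfun_compose flip: ay(1))
    also have "\<dots> \<le> 2 * (norm ((\<mu> *\<^sub>R x) h) * norm (y h))"
      using Re_cinner_le by simp
    also have "\<dots> \<le> 2 * (\<mu> * norm h * norm h)"
      using mx[of h] norm_blinfun_le[OF y(2), of h] \<open>\<mu> > 0\<close> by (intro mult_left_mono mult_mono) auto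
    finally show "norm (f (y h)) \<le> \<epsilon> / 2 * norm h"
      unfolding sq by (rule power2_le_imp_le) (use \<open>\<epsilon> > 0\<close> in simp)
    have "(norm (adj f (adj y h)))\<^sup>2 \<le> 2 * Re (cinner (a (adj y h)) (adj y h))"
      using norm_adj_sq_le_of_norm_id_minus_le_1[OF F'(2,3)[OF f], of "adj y h"]
        dom[OF f, of "adj y h"] by simp
    also have "\<dots> = 2 * Re (cinner ((\<mu> *\<^sub>R x) (adj y h)) h)"
      by (simp only: blinfun_apply_blinfun_compose cinner_adj[OF y(1)] flip: ay(2))
    also have "\<dots> \<le> 2 * (norm ((\<mu> *\<^sub>R x) (adj y h)) * norm h)"
      using Re_cinner_le by simp
    also have "\<dots> \<le> 2 * (\<mu> * norm h * norm h)"
    proof -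
      have "norm (adj y h) \<le> 1 * norm h"
        using norm_adj_le[OF y(1)] y(2) by (intro norm_blinfun_le) simp
      then have "\<mu> * norm (adj y h) \<le> \<mu> * norm h"
        using \<open>\<mu> > 0\<close> by simp
      then show ?thesis
        using mx[of "adj y h"] by (intro mult_left_mono mult_right_mono) auto
    qed
    finally show "norm (adj f (adj y h)) \<le> \<epsilon> / 2 * norm h"
      unfolding sq by (rule power2_le_imp_le) (use \<open>\<epsilon> > 0\<close> in simp)
  qed
  have "norm ((x o\<^sub>L f) - f) < \<epsilon>" "norm ((f o\<^sub>L x) - f) < \<epsilon>" if f: "f \<in> F" for f
  proof -
    have "norm (f o\<^sub>L y) \<le> \<epsilon> / 2"
      using small(1)[OF f] \<open>\<epsilon> > 0\<close> by (intro norm_blinfun_bound) auto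
    moreover have "(f o\<^sub>L x) - f = - (f o\<^sub>L y)"
      by (intro blinfun_eqI) (simp add: y_def blinfun.diff_left blinfun.diff_right blinfun.minus_left)
    ultimately show "norm ((f o\<^sub>L x) - f) < \<epsilon>"
      using \<open>\<epsilon> > 0\<close> by simp
    have "norm (y o\<^sub>L f) \<le> \<epsilon> / 2"
    proof (rule norm_blinfun_bound)
      fix h
      define k where "k = y (f h)"
      have "norm k * norm k = Re (cinner h (adj f (adj y k)))"
        by (simp add: k_def cinner_self power2_eq_square
            flip: cinner_adj[OF y(1)] cinner_adj[OF F'(2)[OF f]])
      also have "\<dots> \<le> norm h * (\<epsilon> / 2 * norm k)"
        using Re_cinner_le[of h] mult_left_mono[OF small(2)[OF f, of k], of "norm h"]
        by (meson norm_ge_zero order_trans)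
      finally have "norm k \<le> \<epsilon> / 2 * norm h"
        using \<open>\<epsilon> > 0\<close> by (cases "k = 0") (auto simp: mult_ac)
      then show "norm ((y o\<^sub>L f) h) \<le> \<epsilon> / 2 * norm h"
        by (simp add: k_def)
    qed (use \<open>\<epsilon> > 0\<close> in simp)
    moreover have "(x o\<^sub>L f) - f = - (y o\<^sub>L f)"
      by (intro blinfun_eqI) (simp add: y_def blinfun.diff_left blinfun.diff_right blinfun.minus_left)
    ultimately show "norm ((x o\<^sub>L f) - f) < \<epsilon>"
      using \<open>\<epsilon> > 0\<close> by simp
  qed
  with x show ?thesis
    using that by blast
qed

section \<open>Limits along nets\<close>

lemma net_tendstoD:
  assumes "net_tendsto I le f l" "\<epsilon> > 0"
  obtains s where "s \<in> I" "\<And>t. t \<in> I \<Longrightarrow> le s t \<Longrightarrow> norm (f t - l) < \<epsilon>"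
  using assms unfolding net_tendsto_def by blast

lemma net_tendsto_bound:
  assumes f: "net_tendsto I le f l" and "0 \<le> K"
    and bound: "\<And>t. t \<in> I \<Longrightarrow> norm (g t - m) \<le> K * norm (f t - l)"
  shows "net_tendsto I le g m"
  unfolding net_tendsto_def
proof (intro allI impI)
  fix \<epsilon> :: real
  assume "\<epsilon> > 0"
  then have "\<epsilon> / (K + 1) > 0"
    using \<open>0 \<le> K\<close> by simp
  then obtain s where s: "s \<in> I" "\<And>t. t \<in> I \<Longrightarrow> le s t \<Longrightarrow> norm (f t - l) < \<epsilon> / (K + 1)"
    using net_tendstoD[OF f] by blast
  have "norm (g t - m) < \<epsilon>" if "t \<in> I" "le s t" for t
  proof -
    have "norm (g t - m) \<le> K * norm (f t - l)"
      using bound that by blast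
    also have "\<dots> \<le> (K + 1) * norm (f t - l)"
      by (simp add: mult_right_mono)
    also have "\<dots> < (K + 1) * (\<epsilon> / (K + 1))"
      using s(2)[OF that] \<open>0 \<le> K\<close> by (intro mult_strict_left_mono) auto
    also have "\<dots> = \<epsilon>"
      using \<open>0 \<le> K\<close> by simp
    finally show ?thesis .
  qed
  with s(1) show "\<exists>s\<in>I. \<forall>t\<in>I. le s t \<longrightarrow> norm (g t - m) < \<epsilon>"
    by blast
qed

lemma net_tendsto_add:
  assumes dir: "directed I le" and f: "net_tendsto I le f l" and g: "net_tendsto I le g m"
  shows "net_tendsto I le (\<lambda>t. f t + g t) (l + m)"
  unfolding net_tendsto_def
proof (intro allI impI)
  fix \<epsilon> :: real
  assume "\<epsilon> > 0"
  then have "\<epsilon> / 2 > 0" by simp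
  obtain s1 where s1: "s1 \<in> I" "\<And>t. t \<in> I \<Longrightarrow> le s1 t \<Longrightarrow> norm (f t - l) < \<epsilon> / 2"
    using net_tendstoD[OF f \<open>\<epsilon> / 2 > 0\<close>] by blast
  obtain s2 where s2: "s2 \<in> I" "\<And>t. t \<in> I \<Longrightarrow> le s2 t \<Longrightarrow> norm (g t - m) < \<epsilon> / 2"
    using net_tendstoD[OF g \<open>\<epsilon> / 2 > 0\<close>] by blast
  obtain u where u: "u \<in> I" "le s1 u" "le s2 u"
    using dir s1(1) s2(1) unfolding directed_def by blast
  have "norm (f t + g t - (l + m)) < \<epsilon>" if "t \<in> I" "le u t" for t
  proof -
    have "le s1 t" "le s2 t"
      using dir u s1(1) s2(1) that unfolding directed_def by (auto dest: transp_onD)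
    then have "norm (f t - l) + norm (g t - m) < \<epsilon>"
      using s1(2)[OF that(1)] s2(2)[OF that(1)] by fastforce
    moreover have "f t + g t - (l + m) = (f t - l) + (g t - m)"
      by simp
    ultimately show ?thesis
      by (metis norm_triangle_ineq le_less_trans)
  qed
  with u(1) show "\<exists>s\<in>I. \<forall>t\<in>I. le s t \<longrightarrow> norm (f t + g t - (l + m)) < \<epsilon>"
    by blast
qed

text \<open>
  Contractivity is what makes the set closed: if \<open>y\<close> is close to \<open>x\<close>, then \<open>g t y\<close> is as close to
  \<open>g t x\<close>, uniformly in \<open>t\<close>.
\<close>

lemma net_fixed_points_closed_subspace:
  fixes g :: "'i \<Rightarrow> 'a :: complex_normed_vector \<Rightarrow> 'a"
  assumes dir: "directed I le"
    and add: "\<And>t x y. t \<in> I \<Longrightarrow> g t (x + y) = g t x + g t y"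
    and scale: "\<And>t c x. t \<in> I \<Longrightarrow> g t (c *\<^sub>C x) = c *\<^sub>C g t x"
    and contr: "\<And>t x. t \<in> I \<Longrightarrow> norm (g t x) \<le> norm x"
  defines "L \<equiv> {x. net_tendsto I le (\<lambda>t. g t x) x}"
  shows "complex_vector.subspace L" "closed L"
proof -
  obtain t0 where t0: "t0 \<in> I"
    using dir by (auto simp: directed_def)
  have diff: "g t (x - y) = g t x - g t y" if "t \<in> I" for t x y
    using add[OF that, of "x - y" y] by simp
  have zero: "g t 0 = 0" if "t \<in> I" for t
    using diff[OF that, of 0 0] by simp
  show "complex_vector.subspace L"
  proof (rule complex_vector.subspaceI)
    show "0 \<in> L"
      using t0 zero by (auto simp: L_def net_tendsto_def)
  next
    fix x y
    assume "x \<in> L" "y \<in> L"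
    then have "net_tendsto I le (\<lambda>t. g t x + g t y) (x + y)"
      unfolding L_def using net_tendsto_add[OF dir] by blast
    then have "net_tendsto I le (\<lambda>t. g t (x + y)) (x + y)"
      by (rule net_tendsto_bound[where K = 1]) (simp_all add: add)
    then show "x + y \<in> L"
      by (simp add: L_def)
  next
    fix c x
    assume "x \<in> L"
    then have "net_tendsto I le (\<lambda>t. g t (c *\<^sub>C x)) (c *\<^sub>C x)"
      unfolding L_def mem_Collect_eq
      by (rule net_tendsto_bound[where K = "cmod c"])
        (simp_all add: scale norm_scaleC flip: complex_vector.scale_right_diff_distrib)
    then show "c *\<^sub>C x \<in> L"
      by (simp add: L_def)
  qed
  have "x \<in> L" if x: "x \<in> closure L" for x
    unfolding L_def net_tendsto_def mem_Collect_eq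
  proof (intro allI impI)
    fix \<epsilon> :: real
    assume "\<epsilon> > 0"
    then have "\<epsilon> / 3 > 0" by simp
    then obtain y where y: "y \<in> L" "norm (y - x) < \<epsilon> / 3"
      using x unfolding closure_approachable dist_norm by blast
    then have "net_tendsto I le (\<lambda>t. g t y) y"
      by (simp add: L_def)
    from net_tendstoD[OF this \<open>\<epsilon> / 3 > 0\<close>]
    obtain s where s: "s \<in> I" "\<And>t. t \<in> I \<Longrightarrow> le s t \<Longrightarrow> norm (g t y - y) < \<epsilon> / 3"
      by blast
    have "norm (g t x - x) < \<epsilon>" if "t \<in> I" "le s t" for t
    proof -
      have "g t x - x = (g t y - y) + (y - x) - g t (y - x)"
        using diff[OF that(1)] by simp
      also have "norm \<dots> \<le> norm (g t y - y) + norm (y - x) + norm (g t (y - x))"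
        using norm_triangle_ineq4 norm_triangle_ineq
        by (meson add_mono_thms_linordered_semiring(3) order_trans)
      also have "\<dots> < \<epsilon>"
        using s(2)[OF that] y(2) contr[OF that(1), of "y - x"] by linarith
      finally show ?thesis .
    qed
    with s(1) show "\<exists>s\<in>I. \<forall>t\<in>I. le s t \<longrightarrow> norm (g t x - x) < \<epsilon>"
      by blast
  qed
  then show "closed L"
    using closure_subset_eq by blast
qed

section \<open>A contractive approximate identity from accretive elements\<close>

text \<open>
  The net is indexed by pairs of a finite subset of \<open>\<FF>\<^sub>A\<close> and a tolerance \<open>1 / (n + 1)\<close>. It converges
  on \<open>\<FF>\<^sub>A\<close> by choice; from there it converges on the products \<open>x a y\<close>, on the left because of
  \<open>x\<close> and on the right because of \<open>y\<close>, and hence on their closed span.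
\<close>

lemma has_cai_if_eq_sub_H:
  assumes A: "operator_algebra A" and eq: "sub_H A = A"
  shows "has_cai A"
proof -
  define I where "I = {(F, n :: nat). finite F \<and> F \<subseteq> frak_F A}"
  define le where "le p q \<longleftrightarrow> fst p \<subseteq> fst q \<and> snd p \<le> snd q"
    for p q :: "('a \<Rightarrow>\<^sub>L 'a) set \<times> nat"
  define good where "good p u \<longleftrightarrow> u \<in> A \<and> norm u \<le> 1 \<and>
      (\<forall>f\<in>fst p. norm ((u o\<^sub>L f) - f) < 1 / real (Suc (snd p)) \<and>
        norm ((f o\<^sub>L u) - f) < 1 / real (Suc (snd p)))" for p u
  have "\<exists>u. good p u" if "p \<in> I" for p
  proof -
    have "0 < 1 / real (Suc (snd p))" by simp
    with that show ?thesis
      using frak_F_finite_approximate_unit[OF A, of "fst p" "1 / real (Suc (snd p))"]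
      unfolding good_def I_def by (auto simp del: of_nat_Suc) metis
  qed
  then have "\<forall>p\<in>I. \<exists>u. good p u" by blast
  then obtain e where e: "\<forall>p\<in>I. good p (e p)"
    using bchoice by blast
  have dir: "directed I le"
    unfolding directed_def
  proof (intro conjI ballI)
    have "({}, 0) \<in> I" by (simp add: I_def)
    then show "I \<noteq> {}" by blast
    show "reflp_on I le" "transp_on I le"
      by (auto simp: le_def reflp_on_def transp_on_def)
    fix p q
    assume "p \<in> I" "q \<in> I"
    then show "\<exists>r\<in>I. le p r \<and> le q r"
      by (intro bexI[of _ "(fst p \<union> fst q, max (snd p) (snd q))"]) (auto simp: I_def le_def)
  qed
  have eA: "e t \<in> A" "e t \<in> bounded_ops" "norm (e t) \<le> 1" if "t \<in> I" for t
  proof -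
    have "good t (e t)"
      using e that by blast
    then show "e t \<in> A" "e t \<in> bounded_ops" "norm (e t) \<le> 1"
      using operator_algebraD(1)[OF A] unfolding good_def by blast+
  qed
  have conv: "net_tendsto I le (\<lambda>t. e t o\<^sub>L f) f" "net_tendsto I le (\<lambda>t. f o\<^sub>L e t) f"
    if "f \<in> frak_F A" for f
  proof -
    have "\<exists>s\<in>I. \<forall>t\<in>I. le s t \<longrightarrow> norm ((e t o\<^sub>L f) - f) < \<epsilon> \<and> norm ((f o\<^sub>L e t) - f) < \<epsilon>"
      if "\<epsilon> > 0" for \<epsilon>
    proof -
      obtain n where n: "1 / real (Suc n) < \<epsilon>"
        using \<open>\<epsilon> > 0\<close> nat_approx_posE by blast
      show ?thesis
      proof (intro bexI[of _ "({f}, n)"] ballI impI)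
        show "({f}, n) \<in> I"
          using \<open>f \<in> frak_F A\<close> by (simp add: I_def)
        fix t
        assume t: "t \<in> I" "le ({f}, n) t"
        then have "f \<in> fst t" "1 / real (Suc (snd t)) \<le> 1 / real (Suc n)"
          by (auto simp: le_def frac_le)
        then show "norm ((e t o\<^sub>L f) - f) < \<epsilon> \<and> norm ((f o\<^sub>L e t) - f) < \<epsilon>"
          using e t(1) n unfolding good_def by fastforce
      qed
    qed
    then show "net_tendsto I le (\<lambda>t. e t o\<^sub>L f) f" "net_tendsto I le (\<lambda>t. f o\<^sub>L e t) f"
      unfolding net_tendsto_def by meson+
  qed
  define L :: "('a \<Rightarrow>\<^sub>L 'a) set" where "L = {x. net_tendsto I le (\<lambda>t. e t o\<^sub>L x) x}"
  define R :: "('a \<Rightarrow>\<^sub>L 'a) set" where "R = {x. net_tendsto I le (\<lambda>t. x o\<^sub>L e t) x}"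
  have LR: "complex_vector.subspace L" "closed L" "complex_vector.subspace R" "closed R"
  proof -
    have scale: "e t o\<^sub>L c *\<^sub>C x = c *\<^sub>C (e t o\<^sub>L x)" "(c *\<^sub>C x) o\<^sub>L e t = c *\<^sub>C (x o\<^sub>L e t)"
      if "t \<in> I" for t c x
      by (intro blinfun_eqI; simp add: scaleC_blinfun.rep_eq bounded_opsD[OF eA(2)[OF that]])+
    have norm: "norm (e t o\<^sub>L x) \<le> norm x" "norm (x o\<^sub>L e t) \<le> norm x" if "t \<in> I" for t x
    proof -
      have "norm (e t) * norm x \<le> norm x" "norm x * norm (e t) \<le> norm x"
        using eA(3)[OF that] by (simp_all add: mult_left_le_one_le mult_right_le_one_le)
      then show "norm (e t o\<^sub>L x) \<le> norm x" "norm (x o\<^sub>L e t) \<le> norm x"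
        using norm_blinfun_compose order_trans by blast+
    qed
    show "complex_vector.subspace L" "closed L"
      unfolding L_def
      by (intro net_fixed_points_closed_subspace dir scale norm;
          simp add: bounded_bilinear.add_right[OF bounded_bilinear_blinfun_compose])+
    show "complex_vector.subspace R" "closed R"
      unfolding R_def
      by (intro net_fixed_points_closed_subspace dir scale norm;
          simp add: bounded_bilinear.add_left[OF bounded_bilinear_blinfun_compose])+
  qed
  have "sub_H A \<subseteq> L \<inter> R"
    unfolding sub_H_def
  proof (intro closed_span_minimal complex_vector.subspace_inter closed_Int LR, safe)
    fix x a y
    assume xy: "x \<in> frak_F A" "y \<in> frak_F A"
    show "x o\<^sub>L a o\<^sub>L y \<in> L"
      unfolding L_def mem_Collect_eq
    proof (rule net_tendsto_bound[OF conv(1)[OF xy(1)], where K = "norm (a o\<^sub>L y)"])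
      fix t
      have "(e t o\<^sub>L (x o\<^sub>L a o\<^sub>L y)) - (x o\<^sub>L a o\<^sub>L y) = ((e t o\<^sub>L x) - x) o\<^sub>L (a o\<^sub>L y)"
        by (intro blinfun_eqI) (simp add: blinfun.diff_left)
      then show "norm ((e t o\<^sub>L (x o\<^sub>L a o\<^sub>L y)) - (x o\<^sub>L a o\<^sub>L y))
          \<le> norm (a o\<^sub>L y) * norm ((e t o\<^sub>L x) - x)"
        by (metis norm_blinfun_compose mult.commute)
    qed simp
    show "x o\<^sub>L a o\<^sub>L y \<in> R"
      unfolding R_def mem_Collect_eq
    proof (rule net_tendsto_bound[OF conv(2)[OF xy(2)], where K = "norm (x o\<^sub>L a)"])
      fix t
      have "(x o\<^sub>L a o\<^sub>L y o\<^sub>L e t) - (x o\<^sub>L a o\<^sub>L y) = (x o\<^sub>L a) o\<^sub>L ((y o\<^sub>L e t) - y)"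
        by (intro blinfun_eqI) (simp add: blinfun.diff_left blinfun.diff_right)
      then show "norm ((x o\<^sub>L a o\<^sub>L y o\<^sub>L e t) - (x o\<^sub>L a o\<^sub>L y))
          \<le> norm (x o\<^sub>L a) * norm ((y o\<^sub>L e t) - y)"
        by (metis norm_blinfun_compose)
    qed simp
  qed
  then have "is_cai A I le e"
    using dir eA unfolding eq is_cai_def L_def R_def by blast
  then show ?thesis
    by (rule has_caiI)
qed

section \<open>Accretive elements from a contractive approximate identity\<close>

lemma has_cai_finite_approximate_unit:
  assumes cai: "has_cai A" and X: "finite X" "X \<subseteq> A" and "\<epsilon> > 0"
  shows "\<exists>u\<in>A. norm u \<le> 1 \<and>
    (\<forall>x\<in>X. norm ((u o\<^sub>L x) - x) < \<epsilon> \<and> norm ((x o\<^sub>L u) - x) < \<epsilon>)"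
proof -
  obtain I and le and e where e: "is_cai A (I :: (('a \<Rightarrow>\<^sub>L 'a) \<times> ('a \<Rightarrow>\<^sub>L 'a) set) set) le e"
    using cai unfolding has_cai_def by blast
  then have dir: "directed I le"
    by (simp add: is_cai_def)
  have "\<exists>s\<in>I. \<forall>t\<in>I. le s t \<longrightarrow>
      (\<forall>x\<in>X. norm ((e t o\<^sub>L x) - x) < \<epsilon> \<and> norm ((x o\<^sub>L e t) - x) < \<epsilon>)"
    using X
  proof (induction X)
    case empty
    then show ?case
      using dir by (auto simp: directed_def)
  next
    case (insert x X)
    then obtain s where s: "s \<in> I" "\<And>t. t \<in> I \<Longrightarrow> le s t \<Longrightarrow>
      (\<forall>x\<in>X. norm ((e t o\<^sub>L x) - x) < \<epsilon> \<and> norm ((x o\<^sub>L e t) - x) < \<epsilon>)"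
      by auto
    have "net_tendsto I le (\<lambda>t. e t o\<^sub>L x) x" "net_tendsto I le (\<lambda>t. x o\<^sub>L e t) x"
      using e insert.prems by (auto simp: is_cai_def)
    from net_tendstoD[OF this(1) \<open>\<epsilon> > 0\<close>] net_tendstoD[OF this(2) \<open>\<epsilon> > 0\<close>]
    obtain s1 s2 where s12: "s1 \<in> I" "\<And>t. t \<in> I \<Longrightarrow> le s1 t \<Longrightarrow> norm ((e t o\<^sub>L x) - x) < \<epsilon>"
      "s2 \<in> I" "\<And>t. t \<in> I \<Longrightarrow> le s2 t \<Longrightarrow> norm ((x o\<^sub>L e t) - x) < \<epsilon>"
      by metis
    obtain u where u: "u \<in> I" "le s u" "le s1 u"
      using dir s(1) s12(1) unfolding directed_def by blast
    obtain v where v: "v \<in> I" "le u v" "le s2 v"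
      using dir u(1) s12(3) unfolding directed_def by blast
    have trans: "le p r" if "le p q" "le q r" "p \<in> I" "q \<in> I" "r \<in> I" for p q r
      using dir that unfolding directed_def by (blast dest: transp_onD)
    show ?case
    proof (intro bexI[of _ v] ballI impI)
      fix t y
      assume t: "t \<in> I" "le v t" and "y \<in> insert x X"
      have "le u t" "le s2 t"
        using trans t v u(1) s12(3) by blast+
      then have "le s t" "le s1 t"
        using trans t(1) u s(1) s12(1) by blast+
      then show "norm ((e t o\<^sub>L y) - y) < \<epsilon> \<and> norm ((y o\<^sub>L e t) - y) < \<epsilon>"
        using \<open>y \<in> insert x X\<close> \<open>le s2 t\<close> s(2) s12(2,4) t(1) by blast
    qed (rule v(1))
  qed
  then obtain s where s: "s \<in> I" "\<forall>t\<in>I. le s t \<longrightarrow>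
      (\<forall>x\<in>X. norm ((e t o\<^sub>L x) - x) < \<epsilon> \<and> norm ((x o\<^sub>L e t) - x) < \<epsilon>)"
    by blast
  moreover have "le s s"
    using dir s(1) by (auto simp: directed_def dest: reflp_onD)
  ultimately show ?thesis
    using e by (intro bexI[of _ "e s"]) (auto simp: is_cai_def)
qed

text \<open>
  A substitute for an increasing sequence of projections: that \<open>e k\<close> almost fixes \<open>e j\<close> for \<open>j < k\<close>
  imitates the relation \<open>e j \<le> e k\<close>.
\<close>

lemma approximate_unit_sequence:
  fixes A :: "('h :: complex_hilbert_space \<Rightarrow>\<^sub>L 'h) set"
  assumes cai: "has_cai A" and X: "finite X" "X \<subseteq> A" and "\<tau> > 0"
  shows "\<exists>e :: nat \<Rightarrow> 'h \<Rightarrow>\<^sub>L 'h. \<forall>k. e k \<in> A \<and> norm (e k) \<le> 1 \<and>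
    (\<forall>x \<in> X \<union> e ` {..<k}. norm ((e k o\<^sub>L x) - x) < \<tau> \<and> norm ((x o\<^sub>L e k) - x) < \<tau>)"
proof -
  define P where "P f k u \<longleftrightarrow> u \<in> A \<and> norm u \<le> 1 \<and>
    (\<forall>x \<in> X \<union> f ` {..<k}. norm ((u o\<^sub>L x) - x) < \<tau> \<and> norm ((x o\<^sub>L u) - x) < \<tau>)"
    for f :: "nat \<Rightarrow> 'h \<Rightarrow>\<^sub>L 'h" and k u
  have "\<exists>f. \<forall>k. P f k (f k)"
  proof (rule dependent_wellorder_choice)
    fix r and f g :: "nat \<Rightarrow> 'h \<Rightarrow>\<^sub>L 'h" and k
    assume "\<And>j. j < k \<Longrightarrow> f j = g j"
    then have "f ` {..<k} = g ` {..<k}"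
      by (intro image_cong) auto
    then show "P f k r = P g k r"
      by (simp only: P_def)
  next
    fix k f
    assume "\<And>j. j < k \<Longrightarrow> P f j (f j)"
    then have "X \<union> f ` {..<k} \<subseteq> A"
      using X(2) by (auto simp: P_def)
    then show "\<exists>u. P f k u"
      using has_cai_finite_approximate_unit[OF cai _ _ \<open>\<tau> > 0\<close>, of "X \<union> f ` {..<k}"] X(1)
      unfolding P_def by blast
  qed
  then show ?thesis
    unfolding P_def .
qed

text \<open>
  If \<open>v\<close> is almost fixed by the contraction \<open>e\<close>, then it is almost fixed by \<open>e\<^sup>*\<close> as well, because
  \<open>\<parallel>v - e\<^sup>* v\<parallel>\<^sup>2 \<le> 2 Re \<langle>v - e v, v\<rangle>\<close>. In pairings with \<open>v\<close>, the operator \<open>e\<close> may therefore be inserted at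
  the other argument.
\<close>

lemma contraction_almost_fixes_inner_product:
  assumes e: "e \<in> bounded_ops" "norm e \<le> 1"
    and \<tau>: "norm (e v - v) \<le> \<tau>" and c: "0 \<le> c" "2 * norm v * \<tau> \<le> c\<^sup>2"
  shows "\<bar>Re (cinner v h) - Re (cinner v (e h))\<bar> \<le> c * norm h"
proof -
  define w where "w = adj e v"
  have "norm w \<le> 1 * norm v"
    unfolding w_def using norm_adj_le[OF e(1)] e(2) by (intro norm_blinfun_le) simp
  then have "(norm w)\<^sup>2 \<le> (norm v)\<^sup>2"
    by (simp add: power_mono)
  moreover have "Re (cinner v w) = (norm v)\<^sup>2 + Re (cinner (e v - v) v)"
    unfolding w_def cinner_adj[OF e(1), symmetric]
    by (simp add: cinner_diff_left cinner_self)
  moreover have "- (norm v * \<tau>) \<le> Re (cinner (e v - v) v)"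
    using abs_Re_cinner_le[of "e v - v" v] mult_right_mono[OF \<tau>, of "norm v"]
    by (simp add: mult.commute[of _ \<tau>])
  ultimately have "(norm (v - w))\<^sup>2 \<le> c\<^sup>2"
    unfolding norm_diff_squared using c(2) by linarith
  then have "norm (v - w) \<le> c"
    using c(1) by (rule power2_le_imp_le)
  have "Re (cinner v (e h)) = Re (cinner w h)"
    unfolding w_def by (simp add: Re_cinner_commute[of v] Re_cinner_commute[of _ h]
        cinner_adj[OF e(1)])
  then have "Re (cinner v h) - Re (cinner v (e h)) = Re (cinner (v - w) h)"
    by (simp add: cinner_diff_left)
  also have "\<bar>\<dots>\<bar> \<le> norm (v - w) * norm h"
    by (rule abs_Re_cinner_le)
  also have "\<dots> \<le> c * norm h"
    using \<open>norm (v - w) \<le> c\<close> by (rule mult_right_mono) simp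
  finally show ?thesis .
qed

text \<open>
  For \<open>d\<close>, \<open>f\<close>, \<open>e\<close> consecutive in an approximate unit sequence, \<open>\<langle>f h, h\<rangle> \<approx> \<langle>f h, e h\<rangle>\<close>, as \<open>f h\<close> is almost
  fixed by \<open>e\<close>. Moreover \<open>2 d h \<approx> d (f h + e h)\<close>, so \<open>2 \<parallel>d h\<parallel>\<close> is nearly a lower bound for \<open>\<parallel>f h + e h\<parallel>\<close>, and
  expanding the square of the latter bounds \<open>Re \<langle>f h, e h\<rangle>\<close> from below. The three coefficients \<open>2\<close>, \<open>- 1 / 2\<close>,
  \<open>- 1 / 2\<close> add up to one: on average over the sequence, \<open>Re \<langle>f h, h\<rangle>\<close> is almost \<open>\<parallel>f h\<parallel>\<^sup>2\<close> or more.
\<close>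

lemma approximate_unit_step:
  assumes d: "d \<in> bounded_ops" "norm d \<le> 1" and f: "norm f \<le> 1" and e: "e \<in> bounded_ops" "norm e \<le> 1"
    and de: "norm ((d o\<^sub>L f) - d) \<le> \<sigma>\<^sup>2" "norm ((d o\<^sub>L e) - d) \<le> \<sigma>\<^sup>2" and ef: "norm ((e o\<^sub>L f) - f) \<le> \<sigma>\<^sup>2"
    and \<sigma>: "0 \<le> \<sigma>" "\<sigma> \<le> 1" and h: "norm h = 1"
  shows "2 * (norm (d h))\<^sup>2 - (norm (f h))\<^sup>2 / 2 - (norm (e h))\<^sup>2 / 2 - 6 * \<sigma> \<le> Re (cinner (f h) h)"
proof -
  have at: "norm (T h) \<le> \<sigma>\<^sup>2" if "norm T \<le> \<sigma>\<^sup>2" for T :: "'a \<Rightarrow>\<^sub>L 'a"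
    using norm_blinfun_le[OF that, of h] h by simp
  have le1: "norm (f h) \<le> 1" "norm (d h) \<le> 1"
    using norm_blinfun_le[OF f, of h] norm_blinfun_le[OF d(2), of h] h by auto
  have "norm (e (f h) - f h) \<le> \<sigma>\<^sup>2"
    using at[OF ef] by (simp add: blinfun.diff_left)
  moreover have "2 * norm (f h) * \<sigma>\<^sup>2 \<le> (2 * \<sigma>)\<^sup>2"
  proof -
    have "norm (f h) * \<sigma>\<^sup>2 \<le> \<sigma>\<^sup>2"
      using mult_right_mono[OF le1(1), of "\<sigma>\<^sup>2"] by simp
    then have "2 * norm (f h) * \<sigma>\<^sup>2 \<le> 4 * \<sigma>\<^sup>2"
      using zero_le_power2[of \<sigma>] by linarith
    then show ?thesis
      by (simp add: power_mult_distrib)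
  qed
  ultimately have "\<bar>Re (cinner (f h) h) - Re (cinner (f h) (e h))\<bar> \<le> 2 * \<sigma> * norm h"
    using \<sigma> by (intro contraction_almost_fixes_inner_product[OF e, where \<tau> = "\<sigma>\<^sup>2"]) simp_all
  then have 1: "Re (cinner (f h) (e h)) - 2 * \<sigma> \<le> Re (cinner (f h) h)"
    by (simp add: h)
  define p where "p = norm (d h)"
  define r where "r = norm (f h + e h)"
  have "2 * p \<le> norm (d (f h + e h)) + 2 * \<sigma>\<^sup>2"
  proof -
    have "2 *\<^sub>R d h = d (f h + e h) - ((d o\<^sub>L f) - d) h - ((d o\<^sub>L e) - d) h"
      by (simp add: blinfun.diff_left blinfun.add_right scaleR_2)
    moreover have "2 * p = norm (2 *\<^sub>R d h)"
      by (simp add: p_def)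
    ultimately have "2 * p = norm (d (f h + e h) - ((d o\<^sub>L f) - d) h - ((d o\<^sub>L e) - d) h)"
      by (simp only:)
    also have "\<dots> \<le> norm (d (f h + e h)) + norm (((d o\<^sub>L f) - d) h) + norm (((d o\<^sub>L e) - d) h)"
      by (intro order_trans[OF norm_triangle_ineq4] add_mono norm_triangle_ineq4 order_refl)
    finally show ?thesis
      using at[OF de(1)] at[OF de(2)] by linarith
  qed
  moreover have "norm (d (f h + e h)) \<le> r"
    using norm_blinfun_le[OF d(2), of "f h + e h"] by (simp add: r_def)
  moreover have "\<sigma>\<^sup>2 \<le> \<sigma>"
    using \<sigma> by (simp add: power2_eq_square mult_left_le)
  ultimately have "2 * p - 2 * \<sigma> \<le> r"
    by linarith
  have "4 * p\<^sup>2 - 8 * \<sigma> \<le> r\<^sup>2"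
  proof (cases "2 * p - 2 * \<sigma> \<ge> 0")
    case True
    then have "(2 * p - 2 * \<sigma>)\<^sup>2 \<le> r\<^sup>2"
      using \<open>2 * p - 2 * \<sigma> \<le> r\<close> by (intro power_mono)
    moreover have "(2 * p - 2 * \<sigma>)\<^sup>2 = 4 * p\<^sup>2 - 8 * (p * \<sigma>) + 4 * \<sigma>\<^sup>2"
      by (simp add: power2_eq_square algebra_simps)
    moreover have "p * \<sigma> \<le> \<sigma>"
      using le1(2) \<sigma> by (simp add: p_def mult_left_le_one_le)
    ultimately show ?thesis
      using zero_le_power2[of \<sigma>] by linarith
  next
    case False
    then have "p * p \<le> 1 * \<sigma>"
      using le1(2) \<sigma> by (intro mult_mono) (auto simp: p_def)
    then show ?thesis
      using zero_le_power2[of r] \<sigma>(1) unfolding power2_eq_square[of p] by linarith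
  qed
  moreover have "r\<^sup>2 = (norm (f h))\<^sup>2 + 2 * Re (cinner (f h) (e h)) + (norm (e h))\<^sup>2"
    by (simp add: r_def norm_add_squared)
  ultimately show ?thesis
    using 1 unfolding p_def by linarith
qed

text \<open>
  Here \<open>\<langle>x h, h\<rangle> \<approx> \<langle>x e h, h\<rangle> \<approx> \<langle>x e h, e h\<rangle>\<close>, the second step because \<open>x e h\<close> is almost fixed by \<open>e\<close>. The
  lower bound \<open>- \<delta>\<close> of the real part is thus only paid for the vector \<open>e h\<close>.
\<close>

lemma approximate_unit_compression:
  assumes e: "e \<in> bounded_ops" "norm e \<le> 1"
    and xe: "norm ((x o\<^sub>L e) - x) \<le> \<sigma>\<^sup>2" and ex: "norm ((e o\<^sub>L x) - x) \<le> \<sigma>\<^sup>2"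
    and \<sigma>: "0 \<le> \<sigma>" "\<sigma> \<le> 1" and M: "norm x \<le> M"
    and re: "re_ge (- \<delta>) x" and h: "norm h = 1"
  shows "- \<delta> * (norm (e h))\<^sup>2 - (2 + M) * \<sigma> \<le> Re (cinner (x h) h)"
proof -
  define v where "v = e h"
  have "norm v \<le> 1"
    using norm_blinfun_le[OF e(2), of h] h by (simp add: v_def)
  have "0 \<le> M"
    using M norm_ge_zero order_trans by blast
  have xv: "norm (x v) \<le> M"
  proof -
    have "norm (x v) \<le> M * norm v"
      by (rule norm_blinfun_le[OF M])
    also have "\<dots> \<le> M"
      using \<open>norm v \<le> 1\<close> \<open>0 \<le> M\<close> by (simp add: mult_left_le)
    finally show ?thesis .
  qed
  have "norm (e (x v) - x v) \<le> \<sigma>\<^sup>2"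
  proof -
    have "norm (((e o\<^sub>L x) - x) v) \<le> \<sigma>\<^sup>2 * norm v"
      by (rule norm_blinfun_le[OF ex])
    also have "\<dots> \<le> \<sigma>\<^sup>2"
      using \<open>norm v \<le> 1\<close> by (simp add: mult_left_le)
    finally show ?thesis
      by (simp add: blinfun.diff_left)
  qed
  moreover have "2 * norm (x v) * \<sigma>\<^sup>2 \<le> ((1 + M) * \<sigma>)\<^sup>2"
  proof -
    have "(1 + M)\<^sup>2 = 1 + 2 * M + M\<^sup>2"
      by (simp add: power2_sum)
    then have "2 * norm (x v) \<le> (1 + M)\<^sup>2"
      using xv zero_le_power2[of M] by linarith
    then show ?thesis
      by (simp add: power_mult_distrib mult_right_mono)
  qed
  ultimately have "\<bar>Re (cinner (x v) h) - Re (cinner (x v) v)\<bar> \<le> (1 + M) * \<sigma> * norm h"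
    using \<sigma> \<open>0 \<le> M\<close> unfolding v_def
    by (intro contraction_almost_fixes_inner_product[OF e]) auto
  then have "Re (cinner (x v) v) - (1 + M) * \<sigma> \<le> Re (cinner (x v) h)"
    by (simp add: h)
  moreover have "- \<delta> * (norm v)\<^sup>2 \<le> Re (cinner (x v) v)"
    using re by (simp add: re_ge_def)
  moreover have "\<bar>Re (cinner (x v - x h) h)\<bar> \<le> \<sigma>\<^sup>2"
  proof -
    have "norm (((x o\<^sub>L e) - x) h) \<le> \<sigma>\<^sup>2 * norm h"
      by (rule norm_blinfun_le[OF xe])
    then show ?thesis
      using abs_Re_cinner_le[of "x v - x h" h] by (simp add: blinfun.diff_left v_def h)
  qed
  moreover have "\<sigma>\<^sup>2 \<le> \<sigma>"
    using \<sigma> by (simp add: power2_eq_square mult_left_le)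
  ultimately show ?thesis
    by (simp add: v_def cinner_diff_left algebra_simps)
qed

text \<open>
  The element \<open>E\<close> is the average of a long approximate unit sequence \<open>e\<^sub>0, e\<^sub>1, \<dots>\<close> for \<open>X\<close>. For a
  unit vector \<open>h\<close> and \<open>s\<^sub>k = \<parallel>e\<^sub>k h\<parallel>\<^sup>2\<close>, the real part of \<open>\<langle>x h, h\<rangle>\<close> is at least \<open>- \<delta> s\<^sub>k\<close> up to small errors, for every
  \<open>k\<close>, and that of \<open>\<langle>E h, h\<rangle>\<close> is at least the average of the \<open>s\<^sub>k\<close>, up to small errors and a telescoping
  sum that is bounded independently of the length. The averages of \<open>s\<^sub>k\<close> cancel in \<open>x + \<delta> E\<close>.
\<close>

lemma has_cai_almost_accretive:
  assumes A: "operator_algebra A" and cai: "has_cai A" and X: "finite X" "X \<subseteq> A"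
    and "0 \<le> \<delta>" "0 < \<eta>"
  obtains E where "E \<in> A" "norm E \<le> 1" "\<And>x. x \<in> X \<Longrightarrow> re_ge (- \<delta>) x \<Longrightarrow> re_ge (- \<eta>) (x + \<delta> *\<^sub>R E)"
proof -
  obtain M where M: "0 < M" "\<And>x. x \<in> X \<Longrightarrow> norm x \<le> M"
    using finite_imp_bounded[OF X(1)] unfolding bounded_pos by blast
  \<comment> \<open>\<open>K \<sigma>\<close> collects the errors of the two estimates per member of the sequence,
    \<open>5 \<delta> / (2 N)\<close> is the contribution of the telescoping sum.\<close>
  define K where "K = 2 + M + 6 * \<delta>"
  have "K > 0"
    using M(1) \<open>0 \<le> \<delta>\<close> by (simp add: K_def)
  define \<sigma> where "\<sigma> = min 1 (\<eta> / (2 * K))"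
  have \<sigma>: "0 < \<sigma>" "\<sigma> \<le> 1"
    using \<open>K > 0\<close> \<open>\<eta> > 0\<close> by (auto simp: \<sigma>_def)
  have "K * \<sigma> \<le> K * (\<eta> / (2 * K))"
    using \<open>K > 0\<close> by (intro mult_left_mono) (auto simp: \<sigma>_def)
  then have K\<sigma>: "K * \<sigma> \<le> \<eta> / 2"
    using \<open>K > 0\<close> by simp
  obtain N0 where N0: "5 * \<delta> / \<eta> < real N0"
    using reals_Archimedean2 by blast
  define N where "N = Suc N0"
  have N: "0 < real N" "5 * \<delta> / 2 \<le> real N * (\<eta> / 2)"
    using N0 \<open>\<eta> > 0\<close> by (auto simp: N_def field_simps)
  have "\<sigma>\<^sup>2 > 0"
    using \<sigma> by simp
  then obtain e :: "nat \<Rightarrow> 'a \<Rightarrow>\<^sub>L 'a" where e: "\<forall>k. e k \<in> A \<and> norm (e k) \<le> 1 \<and>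
      (\<forall>x \<in> X \<union> e ` {..<k}. norm ((e k o\<^sub>L x) - x) < \<sigma>\<^sup>2 \<and> norm ((x o\<^sub>L e k) - x) < \<sigma>\<^sup>2)"
    using approximate_unit_sequence[OF cai X] by blast
  have eA: "e k \<in> A" "norm (e k) \<le> 1" for k
    using e by blast+
  have unit: "norm ((e k o\<^sub>L x) - x) \<le> \<sigma>\<^sup>2" "norm ((x o\<^sub>L e k) - x) \<le> \<sigma>\<^sup>2"
    if "x \<in> X \<union> e ` {..<k}" for x k
    using e that by (blast intro: less_imp_le)+
  have eb: "e k \<in> bounded_ops" for k
    using eA(1) operator_algebraD(1)[OF A] by blast
  define E where "E = (1 / real N) *\<^sub>R (\<Sum>m<N. e (Suc m))"
  have "E \<in> A"
    unfolding E_def using eA(1)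
    by (intro scaleR_mem_subspace complex_vector.subspace_sum operator_algebraD(2)[OF A])
  moreover have "norm E \<le> 1"
  proof -
    have "norm (\<Sum>m<N. e (Suc m)) \<le> (\<Sum>m<N. 1)"
      using eA(2) by (intro sum_norm_le)
    then show ?thesis
      using N(1) by (simp add: E_def)
  qed
  moreover have "re_ge (- \<eta>) (x + \<delta> *\<^sub>R E)" if x: "x \<in> X" "re_ge (- \<delta>) x" for x
  proof (rule re_ge_unit_sphereI)
    fix h :: 'a
    assume h: "norm h = 1"
    define s where "s k = (norm (e k h))\<^sup>2" for k
    have s: "0 \<le> s k" "s k \<le> 1" for k
      using norm_blinfun_le[OF eA(2), of k h] h by (auto simp: s_def abs_square_le_1)
    have step: "2 * s m - s (Suc m) / 2 - s (Suc (Suc m)) / 2 - 6 * \<sigma>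
        \<le> Re (cinner (e (Suc m) h) h)" for m
      unfolding s_def using \<sigma> h
      by (intro approximate_unit_step eb eA(2) unit) auto
    have "(\<Sum>m<N. s (Suc m)) - 5 / 2 - real N * (6 * \<sigma>) \<le> (\<Sum>m<N. Re (cinner (e (Suc m) h) h))"
    proof -
      have "(\<Sum>m<N. (2 * s m - s (Suc m) / 2 - s (Suc (Suc m)) / 2 - 6 * \<sigma>) - s (Suc m))
          = (\<Sum>m<N. 2 * (s m - s (Suc m)) + (s (Suc m) - s (Suc (Suc m))) / 2 - 6 * \<sigma>)"
        by (intro sum.cong) (auto simp: field_simps)
      also have "\<dots> = 2 * (s 0 - s N) + (s 1 - s (Suc N)) / 2 - real N * (6 * \<sigma>)"
        using sum_lessThan_telescope'[of s N] sum_lessThan_telescope'[of "\<lambda>m. s (Suc m)" N]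
        by (simp add: sum.distrib sum_subtractf flip: sum_distrib_left sum_divide_distrib)
      also have "\<dots> \<ge> - 5 / 2 - real N * (6 * \<sigma>)"
        using s(1)[of 0] s(2)[of N] s(1)[of 1] s(2)[of "Suc N"] by (simp add: field_simps)
      finally have "- 5 / 2 - real N * (6 * \<sigma>) \<le>
          (\<Sum>m<N. 2 * s m - s (Suc m) / 2 - s (Suc (Suc m)) / 2 - 6 * \<sigma>) - (\<Sum>m<N. s (Suc m))"
        by (simp only: sum_subtractf)
      moreover have "(\<Sum>m<N. 2 * s m - s (Suc m) / 2 - s (Suc (Suc m)) / 2 - 6 * \<sigma>)
          \<le> (\<Sum>m<N. Re (cinner (e (Suc m) h) h))"
        by (intro sum_mono step)
      ultimately show ?thesis
        by linarith
    qed
    from mult_left_mono[OF this \<open>0 \<le> \<delta>\<close>]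
    have E: "\<delta> * (\<Sum>m<N. s (Suc m)) - 5 * \<delta> / 2 - real N * (6 * \<delta> * \<sigma>)
        \<le> \<delta> * (\<Sum>m<N. Re (cinner (e (Suc m) h) h))"
      by (simp add: algebra_simps)
    have "(\<Sum>m<N. - \<delta> * s (Suc m) - (2 + M) * \<sigma>) \<le> (\<Sum>m<N. Re (cinner (x h) h))"
      unfolding s_def using \<sigma> h M(2) x
      by (intro sum_mono approximate_unit_compression eb eA(2) unit) auto
    then have "- \<delta> * (\<Sum>m<N. s (Suc m)) - real N * ((2 + M) * \<sigma>) \<le> real N * Re (cinner (x h) h)"
      by (simp only: sum_subtractf sum_constant card_lessThan flip: sum_distrib_left)
    moreover have "real N * Re (cinner ((x + \<delta> *\<^sub>R E) h) h)
        = real N * Re (cinner (x h) h) + \<delta> * (\<Sum>m<N. Re (cinner (e (Suc m) h) h))"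
      using N(1) by (simp add: E_def blinfun.add_left blinfun.scaleR_left blinfun.sum_left
          cinner_add_left cinner_scaleR_left cinner_sum_left algebra_simps)
    ultimately have "- real N * (K * \<sigma>) - 5 * \<delta> / 2 \<le> real N * Re (cinner ((x + \<delta> *\<^sub>R E) h) h)"
      using E by (simp add: K_def algebra_simps)
    moreover have "real N * (K * \<sigma>) \<le> real N * (\<eta> / 2)"
      using K\<sigma> by (intro mult_left_mono) auto
    ultimately have "real N * (- \<eta>) \<le> real N * Re (cinner ((x + \<delta> *\<^sub>R E) h) h)"
      using N(2) by simp
    then show "- \<eta> \<le> Re (cinner ((x + \<delta> *\<^sub>R E) h) h)"
      using N(1) by (simp only: mult_le_cancel_left_pos)
  qed
  ultimately show ?thesis
    using that by blast
qed

text \<open>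
  Adding suitable elements of norm at most \<open>\<delta>\<close>, \<open>\<delta> / 2\<close>, \<open>\<delta> / 4\<close>, \<dots> halves the defect of
  accretivity each time; the limit is accretive.
\<close>

lemma has_cai_accretive_nearby:
  assumes A: "operator_algebra A" and cai: "has_cai A"
    and x: "x \<in> A" "re_ge (- \<delta>) x" and "\<delta> > 0"
  obtains b where "b \<in> frak_r A" "norm (b - x) \<le> 2 * \<delta>"
proof -
  \<comment> \<open>The clause for \<open>n = 0\<close> pins the start of the chosen sequence to \<open>x\<close>.\<close>
  define P where "P n y \<longleftrightarrow> y \<in> A \<and> re_ge (- (\<delta> / 2 ^ n)) y \<and> (n = 0 \<longrightarrow> y = x)" for n :: nat and y
  define Q where "Q n y z \<longleftrightarrow> norm (z - y) \<le> \<delta> / 2 ^ n" for n :: nat and y z :: "'a \<Rightarrow>\<^sub>L 'a"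
  have "\<exists>f. \<forall>n. P n (f n) \<and> Q n (f n) (f (Suc n))"
  proof (rule dependent_nat_choice)
    show "\<exists>y. P 0 y"
      using x by (auto simp: P_def)
    fix y n
    assume y: "P n y"
    have "0 \<le> \<delta> / 2 ^ n" "0 < \<delta> / 2 ^ Suc n"
      using \<open>\<delta> > 0\<close> by auto
    moreover have "{y} \<subseteq> A"
      using y by (simp add: P_def)
    ultimately obtain E where E: "E \<in> A" "norm E \<le> 1"
      "re_ge (- (\<delta> / 2 ^ Suc n)) (y + (\<delta> / 2 ^ n) *\<^sub>R E)"
      using has_cai_almost_accretive[OF A cai, of "{y}"] y unfolding P_def
      by (metis finite.emptyI finite.insertI singletonI)
    have "norm ((\<delta> / 2 ^ n) *\<^sub>R E) \<le> \<delta> / 2 ^ n"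
      using E(2) \<open>\<delta> > 0\<close> by (simp add: mult_left_le divide_right_mono)
    moreover have "y + (\<delta> / 2 ^ n) *\<^sub>R E \<in> A"
      using y E(1)
      by (intro complex_vector.subspace_add scaleR_mem_subspace operator_algebraD(2)[OF A])
        (auto simp: P_def)
    ultimately show "\<exists>z. P (Suc n) z \<and> Q n y z"
      using E(3) by (intro exI[of _ "y + (\<delta> / 2 ^ n) *\<^sub>R E"]) (simp add: P_def Q_def)
  qed
  then obtain f where f: "\<And>n. P n (f n)" "\<And>n. Q n (f n) (f (Suc n))"
    by blast
  have geom: "(\<lambda>n. \<delta> / 2 ^ n) sums (2 * \<delta>)"
    using sums_mult[OF geometric_sums[of "1 / 2 :: real"], of \<delta>]
    by (simp add: power_divide mult.commute)
  have bound: "norm (f (Suc n) - f n) \<le> \<delta> / 2 ^ n" for n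
    using f(2) by (simp add: Q_def)
  have summ: "summable (\<lambda>n. norm (f (Suc n) - f n))"
    by (rule summable_comparison_test'[OF sums_summable[OF geom], of 0]) (use bound in simp)
  define S where "S = (\<Sum>n. f (Suc n) - f n)"
  have "(\<lambda>n. \<Sum>i<n. f (Suc i) - f i) \<longlonglongrightarrow> S"
    unfolding S_def by (rule summable_LIMSEQ[OF summable_norm_cancel[OF summ]])
  moreover have "f 0 = x"
    using f(1)[of 0] by (simp add: P_def)
  ultimately have "(\<lambda>n. f n - x) \<longlonglongrightarrow> S"
    by (simp add: sum_lessThan_telescope)
  from tendsto_add[OF this tendsto_const[of x]] have lim: "f \<longlonglongrightarrow> S + x"
    by simp
  have "norm S \<le> (\<Sum>n. norm (f (Suc n) - f n))"
    unfolding S_def by (rule summable_norm[OF summ])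
  also have "\<dots> \<le> (\<Sum>n. \<delta> / 2 ^ n)"
    by (intro suminf_le bound summ sums_summable[OF geom])
  also have "\<dots> = 2 * \<delta>"
    using geom by (simp add: sums_iff)
  finally have "norm S \<le> 2 * \<delta>" .
  have "f n \<in> A" for n
    using f(1) by (simp add: P_def)
  then have "S + x \<in> A"
    by (rule closed_sequentially[OF operator_algebraD(3)[OF A] _ lim])
  moreover have "re_ge 0 (S + x)"
  proof -
    have "(\<lambda>n. f n + (\<delta> / 2 ^ n) *\<^sub>R id_blinfun) \<longlonglongrightarrow> (S + x) + 0 *\<^sub>R id_blinfun"
      by (intro tendsto_intros lim summable_LIMSEQ_zero[OF sums_summable[OF geom]])
    moreover have "f n + (\<delta> / 2 ^ n) *\<^sub>R id_blinfun \<in> {T. re_ge 0 T}" for n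
    proof -
      have "re_ge (- (\<delta> / 2 ^ n)) (f n)"
        using f(1) by (simp add: P_def)
      then have "0 \<le> Re (cinner (f n h) h) + (\<delta> / 2 ^ n) * (norm h)\<^sup>2" for h
        unfolding re_ge_def by (metis add.commute diff_ge_0_iff_ge diff_minus_eq_add mult_minus_left)
      moreover have "Re (cinner ((f n + (\<delta> / 2 ^ n) *\<^sub>R id_blinfun) h) h)
          = Re (cinner (f n h) h) + (\<delta> / 2 ^ n) * (norm h)\<^sup>2" for h
        by (simp add: blinfun.add_left blinfun.scaleR_left cinner_add_left cinner_scaleR_left
            cinner_self)
      ultimately have "0 \<le> Re (cinner ((f n + (\<delta> / 2 ^ n) *\<^sub>R id_blinfun) h) h)" for h
        by (simp only:)
      then show ?thesis
        by (simp add: re_ge_def)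
    qed
    ultimately show ?thesis
      using closed_sequentially[OF closed_re_ge_0] by fastforce
  qed
  ultimately show ?thesis
    using that[of "S + x"] \<open>norm S \<le> 2 * \<delta>\<close> by (simp add: frak_r_iff[OF operator_algebraD(1)[OF A]])
qed

text \<open>
  For one and the same \<open>E\<close>, both \<open>a + \<parallel>a\<parallel> E\<close> and \<open>- a + \<parallel>a\<parallel> E\<close> are almost accretive, hence close to
  accretive elements; half their difference is \<open>a\<close>.
\<close>

lemma has_cai_imp_closed_span_frak_r:
  assumes A: "operator_algebra A" and cai: "has_cai A"
  shows "A \<subseteq> closed_span (frak_r A)"
proof
  fix a
  assume a: "a \<in> A"
  then have ma: "- a \<in> A"
    using operator_algebraD(2)[OF A] complex_vector.subspace_neg by blast
  have "\<exists>y\<in>closed_span (frak_r A). dist y a < \<epsilon>" if "\<epsilon> > 0" for \<epsilon>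
  proof -
    define \<eta> where "\<eta> = \<epsilon> / 3"
    have "\<eta> > 0"
      using that by (simp add: \<eta>_def)
    obtain E where E: "E \<in> A"
      "\<And>x. x \<in> {a, - a} \<Longrightarrow> re_ge (- norm a) x \<Longrightarrow> re_ge (- \<eta>) (x + norm a *\<^sub>R E)"
      using has_cai_almost_accretive[OF A cai, of "{a, - a}" "norm a" \<eta>] a ma \<open>\<eta> > 0\<close>
      by (metis empty_subsetI finite.emptyI finite.insertI insert_subset norm_ge_zero)
    have "norm a *\<^sub>R E \<in> A"
      using E(1) by (intro scaleR_mem_subspace operator_algebraD(2)[OF A])
    then have mem: "x + norm a *\<^sub>R E \<in> A" if "x \<in> A" for x
      using that by (intro complex_vector.subspace_add operator_algebraD(2)[OF A])
    have "re_ge (- \<eta>) (a + norm a *\<^sub>R E)" "re_ge (- \<eta>) (- a + norm a *\<^sub>R E)"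
      using E(2)[of a] E(2)[of "- a"] re_ge_norm[of a] re_ge_norm[of "- a"] by auto
    then obtain b c where b: "b \<in> frak_r A" "norm (b - (a + norm a *\<^sub>R E)) \<le> 2 * \<eta>"
      and c: "c \<in> frak_r A" "norm (c - (- a + norm a *\<^sub>R E)) \<le> 2 * \<eta>"
      using has_cai_accretive_nearby[OF A cai mem _ \<open>\<eta> > 0\<close>] a ma by metis
    have "(1 / 2) *\<^sub>R (b - c) \<in> closed_span (frak_r A)"
      using b(1) c(1) closed_span_superset
      by (intro scaleR_mem_subspace complex_vector.subspace_diff closed_span_subspace) auto
    moreover have "2 *\<^sub>R ((1 / 2) *\<^sub>R (b - c) - a)
        = (b - (a + norm a *\<^sub>R E)) - (c - (- a + norm a *\<^sub>R E))"
      by (simp add: scaleR_diff_right) (simp add: scaleR_2)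
    then have "2 * norm ((1 / 2) *\<^sub>R (b - c) - a) \<le> 2 * \<eta> + 2 * \<eta>"
      using b(2) c(2) norm_triangle_ineq4[of "b - (a + norm a *\<^sub>R E)" "c - (- a + norm a *\<^sub>R E)"]
        norm_scaleR[of 2 "(1 / 2) *\<^sub>R (b - c) - a"] by simp
    ultimately show ?thesis
      using that by (intro bexI[of _ "(1 / 2) *\<^sub>R (b - c)"]) (auto simp: dist_norm \<eta>_def)
  qed
  then have "a \<in> closure (closed_span (frak_r A))"
    by (simp add: closure_approachable)
  then show "a \<in> closed_span (frak_r A)"
    using closed_closed_span closure_closed by blast
qed

section \<open>Spans of accretive elements and approximate identities\<close>

theorem corollary4p3:
  fixes A :: "('h :: complex_hilbert_space \<Rightarrow>\<^sub>L 'h) set"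
  assumes "operator_algebra A"
  shows "(sub_H A = closed_span (frak_r A) \<and>
          frak_r A = frak_r (sub_H A) \<and> frak_r (sub_H A) \<subseteq> sub_H A) \<and>
         (has_cai A \<longleftrightarrow> A = closed_span (frak_r A))"
proof (intro conjI)
  show span: "sub_H A = closed_span (frak_r A)"
    by (rule sub_H_eq_closed_span_frak_r[OF assms])
  show "frak_r A = frak_r (sub_H A)"
    by (simp add: frak_r_sub_H[OF assms])
  show "frak_r (sub_H A) \<subseteq> sub_H A"
    by (auto simp: frak_r_def)
  have "closed_span (frak_r A) \<subseteq> A"
    using sub_H_subset[OF assms] by (simp add: span)
  then show "has_cai A \<longleftrightarrow> A = closed_span (frak_r A)"
    using has_cai_imp_closed_span_frak_r[OF assms] has_cai_if_eq_sub_H[OF assms] span by blast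
qed

end
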